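(* Let $n\in\{2,3\}$, $g>0$, $\sigma\ge 0$, and $c=(c',0)\in\mathbb{R}^{n-1}\times\mathbb{R}$ with $c\neq 0$. Let $\eta\in C^2(\mathbb{R}^{n-1})$, let $\Omega=\{(x',x_n)\in\mathbb{R}^{n-1}\times\mathbb{R}: x_n<\eta(x')\}$ with boundary $S=\{x_n=\eta(x')\}$ and outward unit normal $N$, and let $\varphi\in C^2(\overline{\Omega})$. Suppose that \begin{align*} \Delta\varphi&=0 && \text{in }\Omega,\\ \nabla\varphi\cdot N&=c\cdot N && \text{on }S,\\ \tfrac12|\nabla\varphi|^2-c\cdot\nabla\varphi+g\eta&=-\sigma\nabla\cdot N && \text{on }S,\\ \eta&\to0 && \text{as }|x'|\to\infty,\\ \varphi,\nabla\varphi&\to0 && \text{as }|x|\to\infty, \end{align*} and that, for some $\varepsilon\in(0,1)$ and all indices $i,j$, $$\varphi=o\Big(\frac1{|x|^{n-2}}\Big)\ \text{ as }|x|\to\infty,$$ $$\eta=O\Big(\frac1{|x'|^{n-1+\varepsilon}}\Big),\quad \frac{\partial\eta}{\partial x'_i}=O\Big(\frac1{|x'|^{n+\varepsilon}}\Big),\quad \frac{\partial^2\eta}{\partial x'_i\partial x'_j}=O\Big(\frac1{|x'|^{n+1+\varepsilon}}\Big)\ \text{ as }|x'|\to\infty.$$ Then the wave has zero excess mass, in that $$\int_{\mathbb{R}^{n-1}}\eta(x')\,dx'=0.$$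
   Context: Write $x=(x',x_n)\in\mathbb{R}^{n-1}\times\mathbb{R}$, with $x'$ horizontal and $x_n$ vertical. The function $\eta$ is the free surface profile, $\varphi$ the velocity potential, $c$ the wave speed, $g$ the gravitational acceleration, $\sigma$ the coefficient of surface tension. The unit normal pointing out of $\Omega$ depends only on $x'$: $N=N(x')=(-\nabla\eta,1)/\sqrt{1+|\nabla\eta|^2}$, so that $\nabla\cdot N=-\nabla\cdot\big(\nabla\eta/\sqrt{1+|\nabla\eta|^2}\big)$. Limits and asymptotic statements for $\varphi,\nabla\varphi$ as $|x|\to\infty$ are taken over $x\in\overline\Omega$. *)

theory Defs
  imports "HOL-Analysis.Analysis" "HOL-Library.Landau_Symbols"
begin

text \<open>
  Points of \<open>\<real>\<^sup>n\<close> are pairs \<open>(x', x\<^sub>n)\<close> of type \<open>(real ^ 'm) \<times> real\<close>, where \<open>CARD('m) = n - 1\<close>.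
  The library's norm and inner product on this product type are the Euclidean ones.
\<close>

definition partial_deriv :: "'a::real_normed_vector \<Rightarrow> ('a \<Rightarrow> real) \<Rightarrow> 'a \<Rightarrow> real" where
  "partial_deriv b f x = frechet_derivative f (at x) b"

definition gradient :: "('a::euclidean_space \<Rightarrow> real) \<Rightarrow> 'a \<Rightarrow> 'a" where
  "gradient f x = (\<Sum>b\<in>Basis. partial_deriv b f x *\<^sub>R b)"

definition divergence :: "('a::euclidean_space \<Rightarrow> 'a) \<Rightarrow> 'a \<Rightarrow> real" where
  "divergence F x = (\<Sum>b\<in>Basis. partial_deriv b (\<lambda>y. F y \<bullet> b) x)"

definition laplacian :: "('a::euclidean_space \<Rightarrow> real) \<Rightarrow> 'a \<Rightarrow> real" where
  "laplacian f x = (\<Sum>b\<in>Basis. partial_deriv b (partial_deriv b f) x)"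

text \<open>
  \<open>C\<^sup>2(U)\<close> for open \<open>U\<close>. Continuity of \<open>f\<close> and of its first derivatives follows from
  their differentiability.
\<close>

definition C2_on :: "'a::euclidean_space set \<Rightarrow> ('a \<Rightarrow> real) \<Rightarrow> bool" where
  "C2_on U f \<longleftrightarrow>
     (\<forall>x\<in>U. f differentiable (at x)) \<and>
     (\<forall>b\<in>Basis. \<forall>x\<in>U. partial_deriv b f differentiable (at x)) \<and>
     (\<forall>b\<in>Basis. \<forall>b'\<in>Basis. continuous_on U (partial_deriv b' (partial_deriv b f)))"

definition extends_continuously :: "'a::topological_space set \<Rightarrow> ('a \<Rightarrow> real) \<Rightarrow> bool" where
  "extends_continuously U f \<longleftrightarrow>
     (\<exists>F. continuous_on (closure U) F \<and> (\<forall>x\<in>U. F x = f x))"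

text \<open>
  \<open>C\<^sup>2\<close> on the closure of an open set \<open>U\<close>: all derivatives of order at most two, taken in \<open>U\<close>,
  extend continuously to the closure. Values of \<open>f\<close> outside the closure are irrelevant.
\<close>

definition C2_closure :: "'a::euclidean_space set \<Rightarrow> ('a \<Rightarrow> real) \<Rightarrow> bool" where
  "C2_closure U f \<longleftrightarrow>
     C2_on U f \<and> continuous_on (closure U) f \<and>
     (\<forall>b\<in>Basis. extends_continuously U (partial_deriv b f)) \<and>
     (\<forall>b\<in>Basis. \<forall>b'\<in>Basis. extends_continuously U (partial_deriv b' (partial_deriv b f)))"

text \<open>
  The gradient on the closure of \<open>U\<close>, that is, the continuous extension of the gradient in \<open>U\<close>.
  Where the gradient is continuous inside \<open>U\<close> the limit is just its value.
\<close>

definition gradient_closure :: "'a::euclidean_space set \<Rightarrow> ('a \<Rightarrow> real) \<Rightarrow> 'a \<Rightarrow> 'a" where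
  "gradient_closure U f x = Lim (at x within U) (gradient f)"

definition fluid_domain :: "('a \<Rightarrow> real) \<Rightarrow> ('a \<times> real) set" where
  "fluid_domain \<eta> = {x. snd x < \<eta> (fst x)}"

definition free_surface :: "('a \<Rightarrow> real) \<Rightarrow> ('a \<times> real) set" where
  "free_surface \<eta> = {x. snd x = \<eta> (fst x)}"

definition unit_normal :: "('a::euclidean_space \<Rightarrow> real) \<Rightarrow> 'a \<Rightarrow> 'a \<times> real" where
  "unit_normal \<eta> x' = (1 / sqrt (1 + (norm (gradient \<eta> x'))\<^sup>2)) *\<^sub>R (- gradient \<eta> x', 1)"

text \<open>\<open>\<nabla> \<cdot> N\<close> is the divergence in \<open>\<real>\<^sup>n\<close> of the normal, extended independently of \<open>x\<^sub>n\<close>.\<close>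

definition div_normal :: "('a::euclidean_space \<Rightarrow> real) \<Rightarrow> 'a \<times> real \<Rightarrow> real" where
  "div_normal \<eta> = divergence (\<lambda>x. unit_normal \<eta> (fst x))"

text \<open>The filter \<open>|x| \<rightarrow> \<infinity>\<close> with \<open>x\<close> restricted to the closure of \<open>U\<close>.\<close>

definition at_infinity_in_closure :: "'a::real_normed_vector set \<Rightarrow> 'a filter" where
  "at_infinity_in_closure U = inf at_infinity (principal (closure U))"

end

theory Submission
  imports Defs
begin

text \<open>
  Multiply the Bernoulli condition by a cutoff \<open>\<chi>\<^sub>R\<close> and integrate over the surface. With the
  kinematic condition, \<open>|\<nabla>\<phi>|\<^sup>2/2 - c \<cdot> \<nabla>\<phi>\<close> splits into the flux through the surface of
  \<open>|\<nabla>\<phi>|\<^sup>2/2 e\<^sub>n - \<partial>\<^sub>n\<phi> \<nabla>\<phi>\<close>, minus the derivative of \<open>x' \<mapsto> \<phi>(x', \<eta>(x'))\<close> in direction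
  \<open>c'\<close>. The field is divergence free, so its cut-off flux is at most a constant times
  \<open>1/R\<close> times the Dirichlet energy of \<open>\<phi>\<close> in the ball of radius \<open>2 R\<close>, and a Caccioppoli
  estimate with \<open>\<phi> \<rightarrow> 0\<close> gives energy \<open>o(R)\<close> since \<open>n \<le> 3\<close>. The tangential derivative integrates to a
  term where the derivative hits the cutoff, and vanishes in the limit because
  \<open>\<phi> = o(|x|\<^bsup>2-n\<^esup>)\<close>. The curvature term is treated likewise. Hence \<open>g \<integral>\<chi>\<^sub>R \<eta>\<close> tends to zero.

  Integral estimates of this kind avoid elliptic regularity up to the boundary.
\<close>

section \<open>Second partial derivatives and integration by parts\<close>

text \<open>With P = \<nabla>\<phi> and vertical component P_n, the field is the vertical row of the
  momentum flux tensor. Its divergence P \<bullet> \<partial>_n P - P \<bullet> \<nabla>P_n - P_n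
  \<Delta>\<phi> vanishes by symmetry of the Hessian and harmonicity. As P \<bullet>
  (-\<nabla>\<eta>, 1) = -c' \<bullet> \<nabla>\<eta>, its flux density is |P|^2/2 + P_n (c'
  \<bullet> \<nabla>\<eta>). The tangential derivative c' \<bullet> P' + P_n (c' \<bullet>
  \<nabla>\<eta>) has the same last term, so it cancels in the difference. Scaling, with d = n - 1
  and |\<phi>| |x|^(d-1) \<le> \<kappa> for |x| \<ge> R: Young's inequality bounds the energy by a
  surface term plus \<kappa>^2/R^2 times a volume of order R^(d+1), at most of order \<kappa>^2 R;
  the tangential term is of order (1/R) (\<kappa>/R^(d-1)) R^d = \<kappa>. The surface term of the
  energy and the curvature are controlled by the L^1 norm of \<nabla>\<eta> and contribute O(1/R).
  The obstacle is regularity: \<phi> is differentiable only in the open domain, its gradient merely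
  extends continuously, so nothing may be differentiated on the surface except \<eta> and the
  cutoff.\<close>

lemma partial_deriv_eq: "(f has_derivative f') (at x) \<Longrightarrow> partial_deriv b f x = f' b"
  unfolding partial_deriv_def using frechet_derivative_at by metis

lemma gradient_inner_Basis: "b \<in> Basis \<Longrightarrow> gradient f x \<bullet> b = partial_deriv b f x"
  unfolding gradient_def by (simp add: inner_sum_left_Basis)

lemma has_derivative_gradient:
  fixes f :: "'a::euclidean_space \<Rightarrow> real"
  assumes "f differentiable (at x)"
  shows "(f has_derivative (\<lambda>v. gradient f x \<bullet> v)) (at x)"
proof -
  let ?f = "frechet_derivative f (at x)"
  have *: "(f has_derivative ?f) (at x)"
    using assms frechet_derivative_works by blast
  have "?f v = gradient f x \<bullet> v" for v
  proof -
    have "?f v = ?f (\<Sum>b\<in>Basis. (v \<bullet> b) *\<^sub>R b)"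
      by (simp add: euclidean_representation)
    also have "\<dots> = (\<Sum>b\<in>Basis. (v \<bullet> b) * ?f b)"
      using has_derivative_linear[OF *] by (simp add: linear_sum linear_cmul)
    also have "\<dots> = (\<Sum>b\<in>Basis. (gradient f x \<bullet> b) * (v \<bullet> b))"
      by (intro sum.cong) (simp_all add: gradient_inner_Basis partial_deriv_def mult.commute)
    also have "\<dots> = gradient f x \<bullet> v"
      by (simp add: euclidean_inner[symmetric])
    finally show ?thesis .
  qed
  then show ?thesis using * by presburger
qed

lemma C2_onD:
  assumes "C2_on U f" "x \<in> U"
  shows "f differentiable (at x)" "b \<in> Basis \<Longrightarrow> partial_deriv b f differentiable (at x)"
  using assms unfolding C2_on_def by auto

lemma C2_on_gradient:
  assumes "C2_on U f" "x \<in> U"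
  shows "(f has_derivative (\<lambda>v. gradient f x \<bullet> v)) (at x)"
    and "b \<in> Basis \<Longrightarrow> (partial_deriv b f has_derivative (\<lambda>v. gradient (partial_deriv b f) x \<bullet> v)) (at x)"
  using C2_onD[OF assms] has_derivative_gradient by blast+

lemma C2_on_continuous_gradient:
  assumes "C2_on U f"
  shows "continuous_on U f" "continuous_on U (gradient f)"
    "b \<in> Basis \<Longrightarrow> continuous_on U (gradient (partial_deriv b f))"
proof -
  show "continuous_on U f"
    using C2_on_gradient(1)[OF assms] has_derivative_continuous
      continuous_at_imp_continuous_on by blast
  have "continuous_on U (partial_deriv b f)" if "b \<in> Basis" for b
    using C2_on_gradient(2)[OF assms _ that] has_derivative_continuous
      continuous_at_imp_continuous_on by blast
  then show "continuous_on U (gradient f)"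
    unfolding gradient_def by (intro continuous_intros) auto
  show "continuous_on U (gradient (partial_deriv b f))" if "b \<in> Basis"
    using assms that unfolding gradient_def C2_on_def by (intro continuous_intros) auto
qed

section \<open>Symmetry of mixed second derivatives\<close>

lemma second_difference:
  fixes f :: "'a::euclidean_space \<Rightarrow> real"
  assumes f: "C2_on U f" and r: "ball x r \<subseteq> U" and b: "b \<in> Basis" "b' \<in> Basis"
    and h: "0 < h" "2 * h < r"
  obtains s t where "0 < s" "s < h" "0 < t" "t < h"
    "f (x + h *\<^sub>R b + h *\<^sub>R b') - f (x + h *\<^sub>R b) - f (x + h *\<^sub>R b') + f x
       = h\<^sup>2 * partial_deriv b' (partial_deriv b f) (x + s *\<^sub>R b + t *\<^sub>R b')"
proof -
  have U: "x + s *\<^sub>R b + t *\<^sub>R b' \<in> U" if "\<bar>s\<bar> \<le> h" "\<bar>t\<bar> \<le> h" for s t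
  proof -
    have "norm (s *\<^sub>R b + t *\<^sub>R b') \<le> \<bar>s\<bar> + \<bar>t\<bar>"
      using norm_triangle_ineq[of "s *\<^sub>R b" "t *\<^sub>R b'"] b by simp
    then have "norm ((x + s *\<^sub>R b + t *\<^sub>R b') - x) < r"
      using h that by (simp add: add.assoc)
    then show ?thesis
      by (intro subsetD[OF r]) (simp only: mem_ball dist_norm norm_minus_commute)
  qed
  have d: "((\<lambda>s. f (x + s *\<^sub>R b + t *\<^sub>R b')) has_real_derivative
      partial_deriv b f (x + s *\<^sub>R b + t *\<^sub>R b')) (at s)" if "\<bar>s\<bar> \<le> h" "\<bar>t\<bar> \<le> h" for s t
  proof -
    have "((\<lambda>s. f (x + s *\<^sub>R b + t *\<^sub>R b')) has_derivative
        (\<lambda>u. gradient f (x + s *\<^sub>R b + t *\<^sub>R b') \<bullet> (u *\<^sub>R b))) (at s)"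
      by (rule has_derivative_compose[where f="\<lambda>s. x + s *\<^sub>R b + t *\<^sub>R b'" and f'="\<lambda>u. u *\<^sub>R b" and g=f, OF _ C2_on_gradient(1)[OF f U[OF that]]])
        (auto intro!: derivative_eq_intros)
    then show ?thesis
      by (simp add: has_field_derivative_def gradient_inner_Basis[OF b(1)] mult_commute_abs)
  qed
  have d': "((\<lambda>t. partial_deriv b f (x + s *\<^sub>R b + t *\<^sub>R b')) has_real_derivative
      partial_deriv b' (partial_deriv b f) (x + s *\<^sub>R b + t *\<^sub>R b')) (at t)"
    if "\<bar>s\<bar> \<le> h" "\<bar>t\<bar> \<le> h" for s t
  proof -
    have "((\<lambda>t. partial_deriv b f (x + s *\<^sub>R b + t *\<^sub>R b')) has_derivative
        (\<lambda>u. gradient (partial_deriv b f) (x + s *\<^sub>R b + t *\<^sub>R b') \<bullet> (u *\<^sub>R b'))) (at t)"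
      by (rule has_derivative_compose[where f="\<lambda>t. x + s *\<^sub>R b + t *\<^sub>R b'" and f'="\<lambda>u. u *\<^sub>R b'" and g="partial_deriv b f", OF _ C2_on_gradient(2)[OF f U[OF that] b(1)]])
        (auto intro!: derivative_eq_intros)
    then show ?thesis
      by (simp add: has_field_derivative_def gradient_inner_Basis[OF b(2)] mult_commute_abs)
  qed
  define g where "g s = f (x + s *\<^sub>R b + h *\<^sub>R b') - f (x + s *\<^sub>R b + 0 *\<^sub>R b')" for s
  have "\<exists>s. 0 < s \<and> s < h \<and> g h - g 0 = (h - 0) * (partial_deriv b f (x + s *\<^sub>R b + h *\<^sub>R b') - partial_deriv b f (x + s *\<^sub>R b + 0 *\<^sub>R b'))"
    unfolding g_def using h by (intro MVT2 DERIV_diff d) auto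
  then obtain s where s: "0 < s" "s < h" "g h - g 0 = h * (partial_deriv b f (x + s *\<^sub>R b + h *\<^sub>R b') - partial_deriv b f (x + s *\<^sub>R b + 0 *\<^sub>R b'))"
    by auto
  have "\<exists>t. 0 < t \<and> t < h \<and> partial_deriv b f (x + s *\<^sub>R b + h *\<^sub>R b') - partial_deriv b f (x + s *\<^sub>R b + 0 *\<^sub>R b') = (h - 0) * partial_deriv b' (partial_deriv b f) (x + s *\<^sub>R b + t *\<^sub>R b')"
    using h s by (intro MVT2 d') auto
  then obtain t where t: "0 < t" "t < h" "partial_deriv b f (x + s *\<^sub>R b + h *\<^sub>R b') - partial_deriv b f (x + s *\<^sub>R b + 0 *\<^sub>R b') = h * partial_deriv b' (partial_deriv b f) (x + s *\<^sub>R b + t *\<^sub>R b')"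
    by auto
  show thesis
    using s t by (intro that[of s t]) (auto simp: g_def power2_eq_square algebra_simps)
qed

text \<open>The second difference is symmetric in \<open>b\<close> and \<open>b'\<close>, so
  \<open>second_difference\<close> applied in both orders equates the two mixed derivatives at two
  points near \<open>x\<close>. Both points tend to \<open>x\<close> as \<open>h\<close> does to 0,
  and continuity concludes.\<close>

lemma second_partial_derivs_commute:
  fixes f :: "'a::euclidean_space \<Rightarrow> real"
  assumes f: "C2_on U f" and "open U" "x \<in> U" and b: "b \<in> Basis" "b' \<in> Basis"
  shows "partial_deriv b (partial_deriv b' f) x = partial_deriv b' (partial_deriv b f) x"
proof -
  let ?A = "partial_deriv b' (partial_deriv b f)" and ?B = "partial_deriv b (partial_deriv b' f)"
  obtain r where r: "r > 0" "ball x r \<subseteq> U"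
    using assms open_contains_ball by blast
  have "isCont ?A x" "isCont ?B x"
    using assms unfolding C2_on_def by (auto simp: continuous_on_eq_continuous_at)
  then have lim: "((\<lambda>h. ?A (p h)) \<longlongrightarrow> ?A x) (at_right 0)" "((\<lambda>h. ?B (p h)) \<longlongrightarrow> ?B x) (at_right 0)"
    if "(p \<longlongrightarrow> x) (at_right 0)" for p :: "real \<Rightarrow> 'a"
    using that isCont_tendsto_compose by blast+
  \<comment> \<open>The guard sits inside the existential, so that choice yields intermediate points
    as total functions of \<open>h\<close>.\<close>
  have "\<forall>h. \<exists>s t s' t'. 0 < h \<and> 2 * h < r \<longrightarrow> 0 < s \<and> s < h \<and> 0 < t \<and> t < h \<and> 0 < s' \<and> s' < h \<and> 0 < t' \<and> t' < h
     \<and> ?A (x + s *\<^sub>R b + t *\<^sub>R b') = ?B (x + s' *\<^sub>R b' + t' *\<^sub>R b)"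
  proof
    fix h
    show "\<exists>s t s' t'. 0 < h \<and> 2 * h < r \<longrightarrow> 0 < s \<and> s < h \<and> 0 < t \<and> t < h \<and> 0 < s' \<and> s' < h \<and> 0 < t' \<and> t' < h
     \<and> ?A (x + s *\<^sub>R b + t *\<^sub>R b') = ?B (x + s' *\<^sub>R b' + t' *\<^sub>R b)"
    proof (cases "0 < h \<and> 2 * h < r")
      case True
      then have h: "0 < h" "2 * h < r" by auto
      obtain s t where st: "0 < s" "s < h" "0 < t" "t < h"
        "f (x + h *\<^sub>R b + h *\<^sub>R b') - f (x + h *\<^sub>R b) - f (x + h *\<^sub>R b') + f x = h\<^sup>2 * ?A (x + s *\<^sub>R b + t *\<^sub>R b')"
        using second_difference[OF f r(2) b h] by blast
      obtain s' t' where st': "0 < s'" "s' < h" "0 < t'" "t' < h"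
        "f (x + h *\<^sub>R b' + h *\<^sub>R b) - f (x + h *\<^sub>R b') - f (x + h *\<^sub>R b) + f x = h\<^sup>2 * ?B (x + s' *\<^sub>R b' + t' *\<^sub>R b)"
        using second_difference[OF f r(2) b(2,1) h] by blast
      have "x + h *\<^sub>R b' + h *\<^sub>R b = x + h *\<^sub>R b + h *\<^sub>R b'" by simp
      then have "h\<^sup>2 * ?A (x + s *\<^sub>R b + t *\<^sub>R b') = h\<^sup>2 * ?B (x + s' *\<^sub>R b' + t' *\<^sub>R b)"
        using st(5) st'(5) by (simp only:)
      then have "?A (x + s *\<^sub>R b + t *\<^sub>R b') = ?B (x + s' *\<^sub>R b' + t' *\<^sub>R b)"
        using h(1) by (metis mult_cancel_left power_eq_0_iff less_irrefl)
      then show ?thesis using st st' by blast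
    qed auto
  qed
  then obtain s t s' t' where *: "\<And>h. 0 < h \<Longrightarrow> 2 * h < r \<Longrightarrow> 0 < s h \<and> s h < h \<and> 0 < t h \<and> t h < h \<and> 0 < s' h \<and> s' h < h \<and> 0 < t' h \<and> t' h < h
     \<and> ?A (x + s h *\<^sub>R b + t h *\<^sub>R b') = ?B (x + s' h *\<^sub>R b' + t' h *\<^sub>R b)"
    by metis
  have ev: "\<forall>\<^sub>F h in at_right 0. 0 < h \<and> 2 * h < r"
    unfolding eventually_at_right_field using r by (intro exI[of _ "r / 2"]) auto
  have z: "(q \<longlongrightarrow> 0) (at_right 0)" if "\<And>h. 0 < h \<Longrightarrow> 2 * h < r \<Longrightarrow> 0 < q h \<and> q h < h" for q :: "real \<Rightarrow> real"
  proof (rule real_tendsto_sandwich[of "\<lambda>_. 0" _ _ "\<lambda>h. h"])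
    show "\<forall>\<^sub>F h in at_right 0. 0 \<le> q h" "\<forall>\<^sub>F h in at_right 0. q h \<le> h"
      by (rule eventually_mono[OF ev]; use that less_imp_le in blast)+
  qed (auto intro: tendsto_ident_at)
  have "((\<lambda>h. x + s h *\<^sub>R b + t h *\<^sub>R b') \<longlongrightarrow> x + 0 *\<^sub>R b + 0 *\<^sub>R b') (at_right 0)"
    "((\<lambda>h. x + s' h *\<^sub>R b' + t' h *\<^sub>R b) \<longlongrightarrow> x + 0 *\<^sub>R b' + 0 *\<^sub>R b) (at_right 0)"
    by (intro tendsto_intros z; simp add: *)+
  then have A: "((\<lambda>h. ?A (x + s h *\<^sub>R b + t h *\<^sub>R b')) \<longlongrightarrow> ?A x) (at_right 0)"
    and B: "((\<lambda>h. ?B (x + s' h *\<^sub>R b' + t' h *\<^sub>R b)) \<longlongrightarrow> ?B x) (at_right 0)"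
    using lim by auto
  have "((\<lambda>h. ?A (x + s h *\<^sub>R b + t h *\<^sub>R b')) \<longlongrightarrow> ?B x) (at_right 0)"
    by (rule Lim_transform_eventually[OF B]) (rule eventually_mono[OF ev], simp add: *)
  then show ?thesis
    using A tendsto_unique trivial_limit_at_right_real by blast
qed

section \<open>Cubes and integrals of derivatives of compactly supported functions\<close>

definition cube :: "real \<Rightarrow> 'a::euclidean_space set" where
  "cube K = cbox (- (K *\<^sub>R One)) (K *\<^sub>R One)"

lemma norm_le_imp_cube: "norm x \<le> K \<Longrightarrow> x \<in> cube K"
  unfolding cube_def mem_box
proof (intro ballI)
  fix i :: 'a assume "norm x \<le> K" "i \<in> Basis"
  then show "- (K *\<^sub>R One) \<bullet> i \<le> x \<bullet> i \<and> x \<bullet> i \<le> K *\<^sub>R One \<bullet> i"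
    using Basis_le_norm[of i x] by (simp add: abs_le_iff)
qed

lemma measure_cube:
  assumes "K \<ge> 0"
  shows "measure lborel (cube K :: 'a::euclidean_space set) = (2 * K) ^ DIM('a)"
proof -
  have "measure lborel (cube K :: 'a set) = (\<Prod>b\<in>(Basis :: 'a set). K *\<^sub>R One \<bullet> b - (- (K *\<^sub>R One)) \<bullet> b)"
    unfolding cube_def using assms by (intro content_cbox) simp
  also have "\<dots> = (\<Prod>b\<in>(Basis :: 'a set). 2 * K)"
    by (intro prod.cong) simp_all
  finally show ?thesis by simp
qed

lemma integral_superset_support:
  fixes h :: "'a::euclidean_space \<Rightarrow> real"
  assumes "\<And>x. x \<notin> A \<Longrightarrow> h x = 0"
  shows "integral A h = integral UNIV h"
proof -
  have "(\<lambda>x. if x \<in> A then h x else 0) = h" using assms by auto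
  then show ?thesis using integral_restrict_UNIV[of A h] by simp
qed

text \<open>Translation invariance: the integral of \<open>h\<close> shifted by
  \<open>t *\<^sub>R b\<close> does not depend on \<open>t\<close>, and differentiation under the
  integral sign at \<open>t = 0\<close> gives the claim. The margin in \<open>r + 1 \<le> K\<close>
  keeps the support inside the cube for all shifts with \<bar>t\<bar> \<le> 1.\<close>

lemma integral_directional_derivative_eq_0:
  fixes h :: "'a::euclidean_space \<Rightarrow> real"
  assumes h: "\<And>x. (h has_derivative h' x) (at x)" and b: "b \<in> Basis"
    and cont: "continuous_on UNIV (\<lambda>x. h' x b)"
    and supp: "\<And>x. norm x \<ge> r \<Longrightarrow> h x = 0" and K: "r + 1 \<le> K"
  shows "integral (cube K) (\<lambda>x. h' x b) = 0"
proof -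
  define J where "J t = integral (cube K) (\<lambda>x. h (x + t *\<^sub>R b))" for t :: real
  have hc: "continuous_on UNIV h"
    using h has_derivative_continuous continuous_at_imp_continuous_on by blast
  have "J t = integral UNIV h" if t: "\<bar>t\<bar> \<le> 1" for t
  proof -
    let ?A = "cbox (- (K *\<^sub>R One) + t *\<^sub>R b) (K *\<^sub>R One + t *\<^sub>R b)"
    have "J t = integral ?A h"
      unfolding J_def cube_def integral_shift_cbox_plus[symmetric] by (simp add: o_def add.commute)
    also have "\<dots> = integral UNIV h"
    proof (rule integral_superset_support)
      fix x assume "x \<notin> ?A"
      then have "x - t *\<^sub>R b \<notin> cube K"
        unfolding cube_def by (auto simp: mem_box algebra_simps)
      then have "norm (x - t *\<^sub>R b) > K" using norm_le_imp_cube[of "x - t *\<^sub>R b" K] by linarith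
      moreover have "norm (x - t *\<^sub>R b) \<le> norm x + norm (t *\<^sub>R b)"
        by (rule norm_triangle_ineq4)
      ultimately show "h x = 0" using b K t by (intro supp) simp
    qed
    finally show ?thesis .
  qed
  then have *: "J t = J 0" if "t \<in> {-1..1}" for t using that by auto
  have d: "((\<lambda>t. h (x + t *\<^sub>R b)) has_real_derivative h' (x + t *\<^sub>R b) b) (at t within {-1..1})" for x t
  proof -
    have "((\<lambda>t. h (x + t *\<^sub>R b)) has_derivative (\<lambda>u. h' (x + t *\<^sub>R b) (u *\<^sub>R b))) (at t within {-1..1})"
      by (rule has_derivative_compose[where f="\<lambda>t. x + t *\<^sub>R b" and f'="\<lambda>u. u *\<^sub>R b" and g=h, OF _ h])
        (auto intro!: derivative_eq_intros)
    then show ?thesis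
      using linear_cmul[OF has_derivative_linear[OF h]] by (simp add: has_field_derivative_def mult_commute_abs)
  qed
  have "(J has_field_derivative integral (cube K) (\<lambda>x. h' (x + 0 *\<^sub>R b) b)) (at 0 within {-1..1})"
    unfolding J_def cube_def
    by (rule leibniz_rule_field_derivative[OF d])
      (auto intro!: integrable_continuous continuous_on_compose2[OF hc]
        continuous_on_compose2[OF cont] continuous_intros simp: split_beta)
  moreover have "(J has_field_derivative 0) (at 0 within {-1..1})"
    by (rule has_field_derivative_transform_within[where f="\<lambda>_. J 0" and d=1, OF _ _ _ *[symmetric]]) simp_all
  ultimately show ?thesis
    using DERIV_unique[of J] by (simp add: at_within_Icc_at)
qed

section \<open>The divergence theorem below a graph\<close>

lemma sum_Basis_Pair_real:
  fixes f :: "'a::euclidean_space \<times> real \<Rightarrow> real"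
  shows "sum f Basis = (\<Sum>b\<in>Basis. f (b, 0)) + f (0, 1)"
proof -
  have "inj_on (\<lambda>b::'a. (b, 0::real)) Basis" by (auto intro!: inj_onI)
  then show ?thesis
    unfolding Basis_prod_def by (subst sum.union_disjoint) (auto simp: sum.reindex)
qed

lemma in_closure_fluid_domain:
  fixes \<eta> :: "'a::euclidean_space \<Rightarrow> real"
  assumes "s \<le> 0"
  shows "(x, \<eta> x + s) \<in> closure (fluid_domain \<eta>)"
proof -
  have "(\<lambda>s. (x, \<eta> x + s)) ` closure {..<0} \<subseteq> closure (fluid_domain \<eta>)"
  proof (rule image_closure_subset)
    show "continuous_on (closure {..<0}) (\<lambda>s. (x, \<eta> x + s))" by (intro continuous_intros)
    have "(\<lambda>s. (x, \<eta> x + s)) ` {..<0} \<subseteq> fluid_domain \<eta>" by (auto simp: fluid_domain_def)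
    then show "(\<lambda>s. (x, \<eta> x + s)) ` {..<0} \<subseteq> closure (fluid_domain \<eta>)"
      using closure_subset by blast
  qed simp
  then show ?thesis using assms by auto
qed

lemma open_fluid_domain:
  fixes \<eta> :: "'a::euclidean_space \<Rightarrow> real"
  assumes "continuous_on UNIV \<eta>"
  shows "open (fluid_domain \<eta>)"
  unfolding fluid_domain_def
  by (intro open_Collect_less continuous_intros continuous_on_compose2[OF assms]) auto

text \<open>The depth is the first coordinate here, matching the rules for integrals with a
  parameter; in \<open>box_int\<close> it is the second.\<close>

lemma continuous_on_flatten:
  fixes \<eta> :: "'a::euclidean_space \<Rightarrow> real"
  assumes "continuous_on UNIV \<eta>" "continuous_on (closure (fluid_domain \<eta>)) f"
  shows "continuous_on ({..0} \<times> UNIV) (\<lambda>p. f (snd p, \<eta> (snd p) + fst p))"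
  by (rule continuous_on_compose2[OF assms(2)])
    (auto intro!: continuous_intros continuous_on_compose2[OF assms(1)] in_closure_fluid_domain)

text \<open>
  In the coordinates \<open>(x', s)\<close> with \<open>x\<^sub>n = \<eta>(x') + s\<close>, the flux of \<open>F\<close> through the graph translated by
  \<open>s\<close> has \<open>s\<close>-derivative equal to the integral of the divergence over that translate, since derivatives
  along the translate integrate to zero. Only derivatives at \<open>s < 0\<close> are needed.
\<close>

lemma divergence_below_graph:
  fixes \<eta> :: "'a::euclidean_space \<Rightarrow> real" and F :: "'a \<times> real \<Rightarrow> 'a \<times> real"
  defines "\<Omega> \<equiv> fluid_domain \<eta>"
  assumes \<eta>: "C2_on UNIV \<eta>"
    and F: "\<And>x. x \<in> \<Omega> \<Longrightarrow> (F has_derivative F' x) (at x)"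
    and F'_cont: "\<And>v. continuous_on \<Omega> (\<lambda>x. F' x v)"
    and F_cont: "continuous_on (closure \<Omega>) F" and D_cont: "continuous_on (closure \<Omega>) D"
    and D: "\<And>x. x \<in> \<Omega> \<Longrightarrow> D x = (\<Sum>b\<in>Basis. F' x b \<bullet> b)"
    and supp: "\<And>x. norm x \<ge> r \<Longrightarrow> F x = 0"
    and H: "\<And>x. \<bar>\<eta> x\<bar> \<le> H" and r: "0 \<le> r" and K: "r + 1 \<le> K" and M: "r + H \<le> M"
  shows "integral (cbox (- (K *\<^sub>R One), - M) (K *\<^sub>R One, 0)) (\<lambda>p. D (fst p, \<eta> (fst p) + snd p))
       = integral (cube K) (\<lambda>x. F (x, \<eta> x) \<bullet> (- gradient \<eta> x, 1))"
proof -
  define J where "J s = integral (cube K) (\<lambda>x. F (x, \<eta> x + s) \<bullet> (- gradient \<eta> x, 1))" for s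
  define E where "E s = integral (cube K) (\<lambda>x. D (x, \<eta> x + s))" for s
  have M0: "0 \<le> M" using H[of 0] r M by linarith
  note cont_\<eta> = C2_on_continuous_gradient(1,2)[OF \<eta>]
  note flat = continuous_on_flatten[OF cont_\<eta>(1), folded \<Omega>_def]
  have F_flat: "continuous_on (A \<times> B) (\<lambda>p. F (snd p, \<eta> (snd p) + fst p) \<bullet> (- gradient \<eta> (snd p), 1))"
    if "A \<subseteq> {..0}" for A B
    using that
    by (intro continuous_intros continuous_on_subset[OF flat[OF F_cont]] continuous_on_compose2[OF cont_\<eta>(2)]) auto
  have below: "(x, \<eta> x + s) \<in> \<Omega>" if "s < 0" for x s
    using that by (simp add: \<Omega>_def fluid_domain_def)
  have J_cont: "continuous_on {- M..0} J"
    unfolding J_def cube_def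
    by (rule integral_continuous_on_param) (use F_flat[of "{- M..0}"] in \<open>auto simp: split_beta\<close>)
  have J_M: "J (- M) = 0"
  proof -
    \<comment> \<open>Since \<open>r + H \<le> M\<close>, the translate by \<open>- M\<close> lies
      entirely below the ball that carries the support.\<close>
    have "F (x, \<eta> x + - M) = 0" for x
    proof (rule supp)
      have "r \<le> \<bar>\<eta> x + - M\<bar>" using H[of x] M by linarith
      also have "\<dots> \<le> norm (x, \<eta> x + - M)"
        using norm_snd_le[where x=x and y="\<eta> x + - M"] by simp
      finally show "r \<le> norm (x, \<eta> x + - M)" .
    qed
    then show ?thesis unfolding J_def by simp
  qed
  have J_deriv: "(J has_vector_derivative E s) (at s)" if s: "s \<in> {- M<..<0}" for s
  proof -
    let ?U = "{- M<..<0}"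
    have F'_flat: "continuous_on (?U \<times> B) (\<lambda>p. F' (snd p, \<eta> (snd p) + fst p) v)" for B v
      by (rule continuous_on_compose2[OF F'_cont[of v]])
        (auto intro!: continuous_intros continuous_on_compose2[OF cont_\<eta>(1)] below)
    have d: "((\<lambda>s. F (x, \<eta> x + s) \<bullet> (- gradient \<eta> x, 1)) has_field_derivative
        F' (x, \<eta> x + s) (0, 1) \<bullet> (- gradient \<eta> x, 1)) (at s within ?U)" if "s \<in> ?U" for s x
    proof -
      have lin: "linear (F' (x, \<eta> x + s))"
        using has_derivative_linear[OF F[OF below]] that by simp
      have "((\<lambda>s. F (x, \<eta> x + s)) has_derivative (\<lambda>u. F' (x, \<eta> x + s) (0, u))) (at s within ?U)"
        using that
        by (intro has_derivative_compose[where f="\<lambda>s. (x, \<eta> x + s)" and f'="\<lambda>u. (0, u)" and g=F, OF _ F[OF below]])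
          (auto intro!: derivative_eq_intros)
      then have *: "((\<lambda>s. F (x, \<eta> x + s) \<bullet> (- gradient \<eta> x, 1)) has_derivative
          (\<lambda>u. F' (x, \<eta> x + s) (0, u) \<bullet> (- gradient \<eta> x, 1))) (at s within ?U)"
        by (rule has_derivative_inner_left)
      have "F' (x, \<eta> x + s) (0, u) \<bullet> (- gradient \<eta> x, 1) = F' (x, \<eta> x + s) (0, 1) \<bullet> (- gradient \<eta> x, 1) * u" for u
      proof -
        have "(0::'a, u) = u *\<^sub>R (0, 1)" by simp
        then show ?thesis
          by (simp only: linear_cmul[OF lin] inner_scaleR_left mult.commute)
      qed
      then show ?thesis
        unfolding has_field_derivative_def by (intro has_derivative_eq_rhs[OF *] ext)
    qed
    have "(J has_field_derivative integral (cube K) (\<lambda>x. F' (x, \<eta> x + s) (0, 1) \<bullet> (- gradient \<eta> x, 1))) (at s within ?U)"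
      unfolding J_def cube_def
    proof (rule leibniz_rule_field_derivative[OF d])
      show "(\<lambda>x. F (x, \<eta> x + t) \<bullet> (- gradient \<eta> x, 1)) integrable_on cbox (- (K *\<^sub>R One)) (K *\<^sub>R One)"
        if "t \<in> ?U" for t
      proof (rule integrable_continuous, rule continuous_on_subset)
        have "continuous_on UNIV (\<lambda>x. (t, x))" by (intro continuous_intros)
        moreover have "?U \<subseteq> {..0}" "(\<lambda>x. (t, x)) ` UNIV \<subseteq> ?U \<times> UNIV" using that by auto
        ultimately show "continuous_on UNIV (\<lambda>x. F (x, \<eta> x + t) \<bullet> (- gradient \<eta> x, 1))"
          using continuous_on_compose2[OF F_flat[of ?U UNIV], of UNIV "\<lambda>x. (t, x)"] by simp
      qed simp
      show "continuous_on (?U \<times> cbox (- (K *\<^sub>R One)) (K *\<^sub>R One))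
          (\<lambda>(s, x). F' (x, \<eta> x + s) (0, 1) \<bullet> (- gradient \<eta> x, 1))"
        unfolding split_beta
      proof (intro continuous_on_inner continuous_on_Pair continuous_on_minus continuous_on_const)
        show "continuous_on (?U \<times> cbox (- (K *\<^sub>R One)) (K *\<^sub>R One)) (\<lambda>p. gradient \<eta> (snd p))"
          by (rule continuous_on_compose2[OF cont_\<eta>(2)]) (auto intro!: continuous_intros)
      qed (rule F'_flat)
    qed (use s in auto)
    moreover have "integral (cube K) (\<lambda>x. F' (x, \<eta> x + s) (0, 1) \<bullet> (- gradient \<eta> x, 1)) = E s"
    proof -
      have s0: "s < 0" using s by simp
      \<comment> \<open>\<open>T' b x\<close> is the derivative of the \<open>b\<close>-component of
        \<open>F\<close> along the translated graph. Summing \<open>T' b x b\<close> over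
        \<open>b\<close> gives the horizontal divergence plus the part of the vertical derivative
        paired with \<nabla>\<eta>. This is exactly the discrepancy between the integrand of J' and
        the full divergence.\<close>
      define T' where "T' b x v = F' (x, \<eta> x + s) (v, gradient \<eta> x \<bullet> v) \<bullet> (b, 0)" for b x v
      have lin: "linear (F' (x, \<eta> x + s))" for x
        using has_derivative_linear[OF F[OF below[OF s0]]] .
      have split: "F' (x, \<eta> x + s) (v, gradient \<eta> x \<bullet> v) = F' (x, \<eta> x + s) (v, 0) + (gradient \<eta> x \<bullet> v) *\<^sub>R F' (x, \<eta> x + s) (0, 1)" for x v
        using linear_add[OF lin[of x], of "(v, 0)" "(gradient \<eta> x \<bullet> v) *\<^sub>R (0, 1)"] linear_cmul[OF lin[of x], of "gradient \<eta> x \<bullet> v" "(0, 1)"]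
        by simp
      have F's: "continuous_on UNIV (\<lambda>x. F' (x, \<eta> x + s) v)" for v
        by (rule continuous_on_compose2[OF F'_cont[of v]])
          (auto intro!: continuous_intros cont_\<eta>(1) below s0)
      have T'_cont: "continuous_on UNIV (\<lambda>x. T' b x v)" for b v
        unfolding T'_def split by (intro continuous_intros F's cont_\<eta>(2))
      have T'_int: "integral (cube K) (\<lambda>x. T' b x b) = 0" if "b \<in> Basis" for b
      proof (rule integral_directional_derivative_eq_0[where h="\<lambda>x. F (x, \<eta> x + s) \<bullet> (b, 0)" and h'="T' b" and r=r])
        show "((\<lambda>x. F (x, \<eta> x + s) \<bullet> (b, 0)) has_derivative T' b x) (at x)" for x
          unfolding T'_def
          by (rule has_derivative_inner_left, rule has_derivative_compose[where f="\<lambda>x. (x, \<eta> x + s)" and f'="\<lambda>u. (u, gradient \<eta> x \<bullet> u)" and g=F, OF _ F[OF below[OF s0]]])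
           (auto intro!: derivative_eq_intros C2_on_gradient(1)[OF \<eta>])
        show "F (x, \<eta> x + s) \<bullet> (b, 0) = 0" if "r \<le> norm x" for x
          using supp[of "(x, \<eta> x + s)"] that norm_fst_le[where x=x and y="\<eta> x + s"] by simp
      qed (fact that T'_cont K)+
      have eq: "F' (x, \<eta> x + s) (0, 1) \<bullet> (- gradient \<eta> x, 1) = D (x, \<eta> x + s) - (\<Sum>b\<in>Basis. T' b x b)" for x
      proof -
        let ?L = "F' (x, \<eta> x + s)"
        have "D (x, \<eta> x + s) = (\<Sum>b\<in>Basis. ?L (b, 0) \<bullet> (b, 0)) + ?L (0, 1) \<bullet> (0, 1)"
          by (simp add: D[OF below[OF s0]] sum_Basis_Pair_real)
        moreover have "(\<Sum>b\<in>Basis. T' b x b) = (\<Sum>b\<in>Basis. ?L (b, 0) \<bullet> (b, 0)) + (\<Sum>b\<in>Basis. (gradient \<eta> x \<bullet> b) * (?L (0, 1) \<bullet> (b, 0)))"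
          unfolding T'_def split by (simp add: inner_add_left sum.distrib)
        moreover have "(\<Sum>b\<in>Basis. (gradient \<eta> x \<bullet> b) * (?L (0, 1) \<bullet> (b, 0))) = fst (?L (0, 1)) \<bullet> gradient \<eta> x"
          by (subst (2) euclidean_inner) (simp add: inner_prod_def mult.commute)
        moreover have "?L (0, 1) \<bullet> (- gradient \<eta> x, 1) = ?L (0, 1) \<bullet> (0, 1) - fst (?L (0, 1)) \<bullet> gradient \<eta> x"
          by (simp add: inner_prod_def)
        ultimately show ?thesis by linarith
      qed
      have D_int: "(\<lambda>x. D (x, \<eta> x + s)) integrable_on cube K"
        unfolding cube_def using s0
        by (intro integrable_continuous continuous_on_compose2[OF D_cont, of _ "\<lambda>x. (x, \<eta> x + s)"])
          (auto intro!: continuous_intros continuous_on_subset[OF cont_\<eta>(1)] in_closure_fluid_domain simp: \<Omega>_def)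
      have T_int: "(\<lambda>x. T' b x b) integrable_on cube K" for b
        unfolding cube_def by (intro integrable_continuous continuous_on_subset[OF T'_cont]) auto
      show ?thesis
      proof -
        have "integral (cube K) (\<lambda>x. \<Sum>b\<in>Basis. T' b x b) = (\<Sum>b\<in>Basis. integral (cube K) (\<lambda>x. T' b x b))"
          by (rule integral_sum) (simp_all add: T_int)
        also have "\<dots> = 0" by (simp add: T'_int)
        finally show ?thesis
          unfolding eq E_def
          by (subst integral_diff[OF D_int integrable_sum[OF _ T_int]]) simp_all
      qed
    qed
    moreover have "at s within ?U = at s" using s by (intro at_within_open) auto
    ultimately show ?thesis
      by (simp only: has_real_derivative_iff_has_vector_derivative)
  qed
  \<comment> \<open>At \<open>s = 0\<close> the flux \<open>J\<close> is only known to be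
    continuous, hence the form of the fundamental theorem that needs derivatives in the interior
    alone.\<close>
  have "(E has_integral (J 0 - J (- M))) {- M..0}"
    by (rule fundamental_theorem_of_calculus_interior[OF _ J_cont J_deriv]) (use M0 in auto)
  then have "integral {- M..0} E = J 0"
    using J_M by (simp add: integral_unique)
  moreover have "integral (cbox (- (K *\<^sub>R One), - M) (K *\<^sub>R One, 0)) (\<lambda>p. D (fst p, \<eta> (fst p) + snd p)) = integral {- M..0} E"
  proof -
    have c: "continuous_on (cbox (- (K *\<^sub>R One), - M) (K *\<^sub>R One, 0)) (\<lambda>p. D (fst p, \<eta> (fst p) + snd p))"
      by (rule continuous_on_compose2[OF D_cont])
       (auto intro!: continuous_intros continuous_on_compose2[OF cont_\<eta>(1)] in_closure_fluid_domain
         simp: \<Omega>_def cbox_Pair_eq)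
    show ?thesis
      using integral_prod_continuous[OF c] integral_swap_continuous[of "- (K *\<^sub>R One)" "- M" "K *\<^sub>R One" 0 "\<lambda>x s. D (x, \<eta> x + s)"] c
      by (simp add: E_def[abs_def] cube_def split_beta)
  qed
  ultimately show ?thesis by (simp add: J_def)
qed

section \<open>Cutoff functions\<close>

text \<open>
  A quadratic spline, rather than a smooth transition, because the energy estimate needs the square
  of the derivative to be bounded by a multiple of the function itself.
\<close>

definition ramp :: "real \<Rightarrow> real" where
  "ramp t = 2 * (max 0 t)\<^sup>2 - 4 * (max 0 (t - 1/2))\<^sup>2 + 2 * (max 0 (t - 1))\<^sup>2"

text \<open>The hat function on [0, 1] with slopes 4 and -4 and peak value 2 at 1/2.\<close>

definition ramp' :: "real \<Rightarrow> real" where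
  "ramp' t = 4 * max 0 t - 8 * max 0 (t - 1/2) + 4 * max 0 (t - 1)"

lemma DERIV_max_0_square: "((\<lambda>t::real. (max 0 (t - a))\<^sup>2) has_real_derivative 2 * max 0 (t - a)) (at t)"
proof (cases t a rule: linorder_cases)
  case less
  have "((\<lambda>t. 0::real) has_real_derivative 0) (at t)" by simp
  then have "((\<lambda>t::real. (max 0 (t - a))\<^sup>2) has_real_derivative 0) (at t)"
    by (rule has_field_derivative_transform_within_open[where S="{..<a}"]) (use less in auto)
  then show ?thesis using less by simp
next
  case greater
  have "((\<lambda>t. (t - a)\<^sup>2) has_real_derivative 2 * (t - a)) (at t)"
    by (auto intro!: derivative_eq_intros)
  then have "((\<lambda>t::real. (max 0 (t - a))\<^sup>2) has_real_derivative 2 * (t - a)) (at t)"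
    by (rule has_field_derivative_transform_within_open[where S="{a<..}"]) (use greater in auto)
  then show ?thesis using greater by simp
next
  case equal
  \<comment> \<open>At the kink the difference quotient is 0 on the left and \<open>y - a\<close> on
    the right.\<close>
  have "((\<lambda>y. ((max 0 (y - a))\<^sup>2 - (max 0 (a - a))\<^sup>2) / (y - a)) \<longlongrightarrow> 0) (at a)"
  proof (rule tendsto_sandwich[where f="\<lambda>y. - \<bar>y - a\<bar>" and h="\<lambda>y. \<bar>y - a\<bar>"])
    have "\<bar>((max 0 (y - a))\<^sup>2 - (max 0 (a - a))\<^sup>2) / (y - a)\<bar> \<le> \<bar>y - a\<bar>" for y
      by (cases "y > a") (auto simp: power2_eq_square max_def)
    then show "\<forall>\<^sub>F y in at a. - \<bar>y - a\<bar> \<le> ((max 0 (y - a))\<^sup>2 - (max 0 (a - a))\<^sup>2) / (y - a)"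
      "\<forall>\<^sub>F y in at a. ((max 0 (y - a))\<^sup>2 - (max 0 (a - a))\<^sup>2) / (y - a) \<le> \<bar>y - a\<bar>"
      by (intro always_eventually allI; smt (verit))+
    have "((\<lambda>y. \<bar>y - a\<bar>) \<longlongrightarrow> \<bar>a - a\<bar>) (at a)" "((\<lambda>y. - \<bar>y - a\<bar>) \<longlongrightarrow> - \<bar>a - a\<bar>) (at a)"
      by (intro tendsto_intros)+
    then show "((\<lambda>y. \<bar>y - a\<bar>) \<longlongrightarrow> 0) (at a)" "((\<lambda>y. - \<bar>y - a\<bar>) \<longlongrightarrow> 0) (at a)" by simp_all
  qed
  then show ?thesis using equal by (simp add: has_field_derivative_iff)
qed

lemma DERIV_ramp: "(ramp has_real_derivative ramp' t) (at t)"
proof -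
  have "((\<lambda>t. 2 * (max 0 (t - 0))\<^sup>2 - 4 * (max 0 (t - 1/2))\<^sup>2 + 2 * (max 0 (t - 1))\<^sup>2) has_real_derivative
      2 * (2 * max 0 (t - 0)) - 4 * (2 * max 0 (t - 1/2)) + 2 * (2 * max 0 (t - 1))) (at t)"
    by (intro DERIV_add DERIV_diff DERIV_cmult DERIV_max_0_square)
  then show ?thesis by (simp add: ramp_def[abs_def] ramp'_def)
qed

lemma continuous_on_ramp' [continuous_intros]:
  "continuous_on S f \<Longrightarrow> continuous_on S (\<lambda>x. ramp' (f x))"
  unfolding ramp'_def by (intro continuous_intros)

lemma ramp_simps:
  "t \<le> 0 \<Longrightarrow> ramp t = 0" "t \<ge> 1 \<Longrightarrow> ramp t = 1"
  "t \<le> 0 \<Longrightarrow> ramp' t = 0" "t \<ge> 1 \<Longrightarrow> ramp' t = 0"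
  by (auto simp: ramp_def ramp'_def max_def power2_eq_square algebra_simps)

lemma ramp_cases:
  obtains "t \<le> 0" "ramp t = 0" "ramp' t = 0"
  | "0 \<le> t" "t \<le> 1/2" "ramp t = 2 * t\<^sup>2" "ramp' t = 4 * t"
  | "1/2 \<le> t" "t \<le> 1" "ramp t = 1 - 2 * (1 - t)\<^sup>2" "ramp' t = 4 * (1 - t)"
  | "1 \<le> t" "ramp t = 1" "ramp' t = 0"
proof -
  consider "t \<le> 0" | "0 < t" "t \<le> 1/2" | "1/2 < t" "t \<le> 1" | "1 < t" by linarith
  then show thesis
  proof cases
    case 1 with that(1) show ?thesis using ramp_simps by auto
  next
    case 2 with that(2) show ?thesis by (auto simp: ramp_def ramp'_def max_def)
  next
    case 3 with that(3) show ?thesis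
      by (auto simp: ramp_def ramp'_def max_def power2_eq_square algebra_simps)
  next
    case 4 with that(4) show ?thesis using ramp_simps by auto
  qed
qed

text \<open>The constant 8 is attained on the first arc, where (4t)^2 = 8 (2t^2). On the second arc,
  with q = (1 - t)^2, the claim 16q \<le> 8 (1 - 2q) amounts to q \<le> 1/4.\<close>

lemma ramp_bounds: "0 \<le> ramp t" "ramp t \<le> 1" "\<bar>ramp' t\<bar> \<le> 2" "(ramp' t)\<^sup>2 \<le> 8 * ramp t"
proof -
  have "0 \<le> ramp t \<and> ramp t \<le> 1 \<and> \<bar>ramp' t\<bar> \<le> 2 \<and> (ramp' t)\<^sup>2 \<le> 8 * ramp t"
  proof (cases t rule: ramp_cases)
    case 2
    have "t\<^sup>2 \<le> (1/2)\<^sup>2" using 2 by (intro power_mono) auto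
    then show ?thesis using 2 by (auto simp: power2_eq_square)
  next
    case 3
    define q where "q = (1 - t)\<^sup>2"
    have "q \<le> (1/2)\<^sup>2" unfolding q_def using 3 by (intro power_mono) auto
    then have "q \<le> 1/4" by (simp add: power_divide)
    moreover have "0 \<le> q" by (simp add: q_def)
    moreover have "(ramp' t)\<^sup>2 = 16 * q" unfolding 3(4) power_mult_distrib by (simp add: q_def)
    moreover have "\<bar>ramp' t\<bar> \<le> 2" unfolding 3(4) using 3(1,2) by simp
    moreover have "ramp t = 1 - 2 * q" using 3 by (simp add: q_def)
    ultimately show ?thesis by auto
  qed auto
  then show "0 \<le> ramp t" "ramp t \<le> 1" "\<bar>ramp' t\<bar> \<le> 2" "(ramp' t)\<^sup>2 \<le> 8 * ramp t" by auto
qed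

text \<open>A function of |x|^2, hence differentiable at the origin. The transition takes place for
  |x| between R and sqrt 2 times R; the outer radius is rounded up to 2R below.\<close>

definition cutoff :: "real \<Rightarrow> 'a::euclidean_space \<Rightarrow> real" where
  "cutoff R x = ramp (2 - (x \<bullet> x) / R\<^sup>2)"

definition cutoff_grad :: "real \<Rightarrow> 'a::euclidean_space \<Rightarrow> 'a" where
  "cutoff_grad R x = (- 2 * ramp' (2 - (x \<bullet> x) / R\<^sup>2) / R\<^sup>2) *\<^sub>R x"

lemma cutoff_has_derivative: "(cutoff R has_derivative (\<lambda>v. cutoff_grad R x \<bullet> v)) (at x)"
proof -
  have "((\<lambda>x. 2 - (x \<bullet> x) / R\<^sup>2) has_derivative (\<lambda>v. - (x \<bullet> v + v \<bullet> x) / R\<^sup>2)) (at x)"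
    by (auto intro!: derivative_eq_intros simp: divide_inverse algebra_simps)
  from has_derivative_compose[OF this DERIV_ramp[unfolded has_field_derivative_def]]
  have "((\<lambda>x. ramp (2 - (x \<bullet> x) / R\<^sup>2)) has_derivative
      (\<lambda>v. ramp' (2 - (x \<bullet> x) / R\<^sup>2) * (- (x \<bullet> v + v \<bullet> x) / R\<^sup>2))) (at x)" .
  moreover have "ramp' (2 - (x \<bullet> x) / R\<^sup>2) * (- (x \<bullet> v + v \<bullet> x) / R\<^sup>2) = cutoff_grad R x \<bullet> v" for v
    by (simp add: cutoff_grad_def inner_commute)
  ultimately show ?thesis
    by (simp only: cutoff_def[abs_def])
qed

lemma continuous_on_cutoff: "continuous_on S (cutoff R)"
  by (intro continuous_at_imp_continuous_on ballI has_derivative_continuous[OF cutoff_has_derivative])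

lemma continuous_on_cutoff_grad: "continuous_on S (cutoff_grad R)"
  unfolding cutoff_grad_def[abs_def] divide_inverse by (intro continuous_intros)

lemma cutoff_bounds: "0 \<le> cutoff R x" "cutoff R x \<le> 1"
  unfolding cutoff_def by (rule ramp_bounds)+

lemma cutoff_outside:
  assumes "R > 0" "norm x \<ge> 2 * R"
  shows "cutoff R x = 0" "cutoff_grad R x = 0"
proof -
  have "(2 * R)\<^sup>2 \<le> (norm x)\<^sup>2" using assms by (intro power_mono) auto
  then have "4 * R\<^sup>2 \<le> x \<bullet> x"
    using zero_le_power2[of R] by (simp add: power_mult_distrib power2_norm_eq_inner)
  then have "2 * R\<^sup>2 \<le> x \<bullet> x"
    using zero_le_power2[of R] by linarith
  then have "2 - (x \<bullet> x) / R\<^sup>2 \<le> 0"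
    using assms(1) by (simp add: pos_le_divide_eq)
  then show "cutoff R x = 0" "cutoff_grad R x = 0"
    by (simp_all add: cutoff_def cutoff_grad_def ramp_simps)
qed

lemma cutoff_inside:
  assumes "R > 0" "norm x \<le> R"
  shows "cutoff R x = 1" "cutoff_grad R x = 0"
proof -
  have "(norm x)\<^sup>2 \<le> R\<^sup>2" using assms by (intro power_mono) auto
  then have "2 - (x \<bullet> x) / R\<^sup>2 \<ge> 1"
    using assms(1) by (simp add: power2_norm_eq_inner field_simps)
  then show "cutoff R x = 1" "cutoff_grad R x = 0"
    by (simp_all add: cutoff_def cutoff_grad_def ramp_simps)
qed

text \<open>Where the gradient is nonzero, |x|^2 \<le> 2 R^2, and
  \<open>(ramp' t)\<^sup>2 \<le> 8 * ramp t\<close> gives 4 * 8 * 2 = 64. The factor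
  \<open>cutoff R x\<close> on the right is what allows the gradient term to be absorbed in the
  energy estimate.\<close>

lemma cutoff_grad_square_le:
  assumes R: "R > 0"
  shows "(norm (cutoff_grad R x))\<^sup>2 \<le> 64 / R\<^sup>2 * cutoff R x" "norm (cutoff_grad R x) \<le> 8 / R"
proof -
  let ?t = "2 - (x \<bullet> x) / R\<^sup>2"
  have eq: "(norm (cutoff_grad R x))\<^sup>2 = 4 * (ramp' ?t)\<^sup>2 * (x \<bullet> x) / (R\<^sup>2)\<^sup>2"
    by (simp add: cutoff_grad_def power_mult_distrib power_divide power2_norm_eq_inner)
  show *: "(norm (cutoff_grad R x))\<^sup>2 \<le> 64 / R\<^sup>2 * cutoff R x"
  proof (cases "?t \<le> 0")
    case True
    then show ?thesis by (simp add: cutoff_grad_def cutoff_def ramp_simps)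
  next
    case False
    then have x: "x \<bullet> x \<le> 2 * R\<^sup>2" using R by (simp add: pos_le_divide_eq not_le)
    have "4 * (ramp' ?t)\<^sup>2 * (x \<bullet> x) \<le> 4 * (8 * ramp ?t) * (2 * R\<^sup>2)"
      using x ramp_bounds[of ?t] by (intro mult_mono) auto
    then have "4 * (ramp' ?t)\<^sup>2 * (x \<bullet> x) / (R\<^sup>2)\<^sup>2 \<le> 4 * (8 * ramp ?t) * (2 * R\<^sup>2) / (R\<^sup>2)\<^sup>2"
      by (intro divide_right_mono) auto
    also have "\<dots> = 64 / R\<^sup>2 * cutoff R x"
      using R by (simp add: cutoff_def power2_eq_square)
    finally show ?thesis unfolding eq .
  qed
  have "64 / R\<^sup>2 * cutoff R x \<le> 64 / R\<^sup>2 * 1"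
    using cutoff_bounds by (intro mult_left_mono) auto
  then have "(norm (cutoff_grad R x))\<^sup>2 \<le> (8 / R)\<^sup>2" using * by (simp add: power_divide)
  then show "norm (cutoff_grad R x) \<le> 8 / R"
    by (rule power2_le_imp_le) (use R in auto)
qed

section \<open>Integral identities for the velocity potential\<close>

definition vert :: "'a::real_vector \<times> real" where "vert = (0, 1)"

lemma vert_Basis [simp]: "(vert :: 'a::euclidean_space \<times> real) \<in> Basis"
  by (simp add: vert_def Basis_prod_def)

text \<open>\<open>P\<close> is the continuous extension of the gradient to the closed domain. On
  the surface \<open>gradient \<phi>\<close> itself says nothing, since it depends on values of
  \<open>\<phi>\<close> outside the closure.\<close>

locale deep_water =
  fixes \<eta> :: "'a::euclidean_space \<Rightarrow> real" and \<phi> :: "'a \<times> real \<Rightarrow> real"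
    and P :: "'a \<times> real \<Rightarrow> 'a \<times> real" and H :: real
  assumes \<eta>_C2: "C2_on UNIV \<eta>" and \<phi>_C2: "C2_on (fluid_domain \<eta>) \<phi>"
    and harmonic: "\<And>x. x \<in> fluid_domain \<eta> \<Longrightarrow> laplacian \<phi> x = 0"
    and \<phi>_cont: "continuous_on (closure (fluid_domain \<eta>)) \<phi>"
    and P_cont: "continuous_on (closure (fluid_domain \<eta>)) P"
    and P_gradient: "\<And>x. x \<in> fluid_domain \<eta> \<Longrightarrow> P x = gradient \<phi> x"
    and H: "\<And>x. \<bar>\<eta> x\<bar> \<le> H"
begin

definition Hess :: "'a \<times> real \<Rightarrow> 'a \<times> real \<Rightarrow> 'a \<times> real" where
  "Hess x v = (\<Sum>b\<in>Basis. (gradient (partial_deriv b \<phi>) x \<bullet> v) *\<^sub>R b)"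

lemma \<eta>_cont: "continuous_on S \<eta>" and grad_\<eta>_cont: "continuous_on S (gradient \<eta>)"
  by (rule continuous_on_subset[OF C2_on_continuous_gradient(1)[OF \<eta>_C2]], simp,
      rule continuous_on_subset[OF C2_on_continuous_gradient(2)[OF \<eta>_C2]], simp)

lemma open_domain: "open (fluid_domain \<eta>)"
  by (intro open_fluid_domain \<eta>_cont)

lemma \<phi>_deriv:
  assumes "x \<in> fluid_domain \<eta>"
  shows "(\<phi> has_derivative (\<lambda>v. P x \<bullet> v)) (at x)"
  unfolding P_gradient[OF assms] by (rule C2_on_gradient(1)[OF \<phi>_C2 assms])

lemma P_deriv:
  assumes x: "x \<in> fluid_domain \<eta>"
  shows "(P has_derivative Hess x) (at x)"
proof -
  have "((\<lambda>y. \<Sum>b\<in>Basis. partial_deriv b \<phi> y *\<^sub>R b) has_derivative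
      (\<lambda>v. \<Sum>b\<in>Basis. (gradient (partial_deriv b \<phi>) x \<bullet> v) *\<^sub>R b)) (at x)"
    by (intro has_derivative_sum has_derivative_scaleR_left C2_on_gradient(2)[OF \<phi>_C2 x])
  then have "(gradient \<phi> has_derivative Hess x) (at x)"
    by (simp only: gradient_def[abs_def] Hess_def[abs_def])
  then show ?thesis
    by (rule has_derivative_transform_within_open[OF _ open_domain x]) (simp add: P_gradient)
qed

lemma Hess_inner: "b \<in> Basis \<Longrightarrow> Hess x v \<bullet> b = gradient (partial_deriv b \<phi>) x \<bullet> v"
  unfolding Hess_def by (simp add: inner_sum_left_Basis)

lemma Hess_sym:
  assumes "x \<in> fluid_domain \<eta>" "b \<in> Basis" "b' \<in> Basis"
  shows "Hess x b \<bullet> b' = Hess x b' \<bullet> b"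
  using assms second_partial_derivs_commute[OF \<phi>_C2 open_domain assms]
  by (simp add: Hess_inner gradient_inner_Basis)

lemma Hess_trace: "x \<in> fluid_domain \<eta> \<Longrightarrow> (\<Sum>b\<in>Basis. Hess x b \<bullet> b) = 0"
  using harmonic[of x] by (simp add: Hess_inner gradient_inner_Basis laplacian_def)

lemma Hess_cont: "continuous_on (fluid_domain \<eta>) (\<lambda>x. Hess x v)"
  unfolding Hess_def by (intro continuous_intros C2_on_continuous_gradient(3)[OF \<phi>_C2]) auto

lemma continuous_on_domain:
  "continuous_on (fluid_domain \<eta>) \<phi>" "continuous_on (fluid_domain \<eta>) P"
  by (rule continuous_on_subset[OF \<phi>_cont closure_subset], rule continuous_on_subset[OF P_cont closure_subset])

text \<open>
  Integrals over the fluid domain, in the coordinates \<open>(x', s)\<close> of \<open>divergence_below_graph\<close>.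
\<close>

definition box_int :: "real \<Rightarrow> real \<Rightarrow> ('a \<times> real \<Rightarrow> real) \<Rightarrow> real" where
  "box_int K M f = integral (cbox (- (K *\<^sub>R One), - M) (K *\<^sub>R One, 0)) (\<lambda>p. f (fst p, \<eta> (fst p) + snd p))"

text \<open>The integral is with respect to dx', without area element: the factor sqrt (1 +
  |\<nabla>\<eta>|^2) cancels against the normalisation of N, which is why fluxes are written with
  (-\<nabla>\<eta>, 1). The second argument of the integrand gives access to \<nabla>\<eta> at the
  point.\<close>

definition surf_int :: "real \<Rightarrow> ('a \<times> real \<Rightarrow> 'a \<Rightarrow> real) \<Rightarrow> real" where
  "surf_int K f = integral (cube K) (\<lambda>x. f (x, \<eta> x) x)"

text \<open>The flux of \<chi> \<phi> \<nabla>\<phi>, with \<chi> the cutoff. Harmonicity removes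
  the Hessian from the divergence, so the integrand extends continuously to the closed domain
  although the Hessian is controlled only inside.\<close>

lemma energy_identity:
  assumes R: "R > 0" "2 * R + 1 \<le> K" "2 * R + H \<le> M"
  shows "box_int K M (\<lambda>x. \<phi> x * (cutoff_grad R x \<bullet> P x) + cutoff R x * (P x \<bullet> P x))
       = surf_int K (\<lambda>p x. cutoff R p * \<phi> p * (P p \<bullet> (- gradient \<eta> x, 1)))"
proof -
  let ?F = "\<lambda>x. (cutoff R x * \<phi> x) *\<^sub>R P x"
  let ?F' = "\<lambda>x v. (cutoff R x * \<phi> x) *\<^sub>R Hess x v
     + (cutoff R x * (P x \<bullet> v) + (cutoff_grad R x \<bullet> v) * \<phi> x) *\<^sub>R P x"
  have "box_int K M (\<lambda>x. \<phi> x * (cutoff_grad R x \<bullet> P x) + cutoff R x * (P x \<bullet> P x))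
     = integral (cube K) (\<lambda>x. ?F (x, \<eta> x) \<bullet> (- gradient \<eta> x, 1))"
    unfolding box_int_def
  proof (rule divergence_below_graph[OF \<eta>_C2, where F="?F" and F'="?F'"])
    show "(?F has_derivative ?F' x) (at x)" if "x \<in> fluid_domain \<eta>" for x
      by (intro has_derivative_scaleR has_derivative_mult cutoff_has_derivative \<phi>_deriv P_deriv that)
    show "continuous_on (fluid_domain \<eta>) (\<lambda>x. ?F' x v)" for v
      by (intro continuous_intros continuous_on_domain continuous_on_cutoff continuous_on_cutoff_grad Hess_cont)
    show "continuous_on (closure (fluid_domain \<eta>)) ?F"
      by (intro continuous_intros \<phi>_cont P_cont continuous_on_cutoff)
    show "continuous_on (closure (fluid_domain \<eta>)) (\<lambda>x. \<phi> x * (cutoff_grad R x \<bullet> P x) + cutoff R x * (P x \<bullet> P x))"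
      by (intro continuous_intros \<phi>_cont P_cont continuous_on_cutoff continuous_on_cutoff_grad)
    show "\<phi> x * (cutoff_grad R x \<bullet> P x) + cutoff R x * (P x \<bullet> P x) = (\<Sum>b\<in>Basis. ?F' x b \<bullet> b)"
      if "x \<in> fluid_domain \<eta>" for x
    proof -
      have "(\<Sum>b\<in>Basis. ?F' x b \<bullet> b) = (\<Sum>b\<in>Basis. (cutoff R x * \<phi> x) * (Hess x b \<bullet> b)
          + cutoff R x * ((P x \<bullet> b) * (P x \<bullet> b)) + \<phi> x * ((cutoff_grad R x \<bullet> b) * (P x \<bullet> b)))"
        by (intro sum.cong) (simp_all add: inner_add_left algebra_simps)
      also have "\<dots> = (cutoff R x * \<phi> x) * (\<Sum>b\<in>Basis. Hess x b \<bullet> b)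
          + cutoff R x * (\<Sum>b\<in>Basis. (P x \<bullet> b) * (P x \<bullet> b)) + \<phi> x * (\<Sum>b\<in>Basis. (cutoff_grad R x \<bullet> b) * (P x \<bullet> b))"
        by (simp only: sum.distrib sum_distrib_left)
      also have "\<dots> = \<phi> x * (cutoff_grad R x \<bullet> P x) + cutoff R x * (P x \<bullet> P x)"
        by (simp only: Hess_trace[OF that] euclidean_inner[symmetric] mult_zero_right add_0 add.commute)
      finally show ?thesis ..
    qed
    show "?F x = 0" if "2 * R \<le> norm x" for x
      using that R by (simp add: cutoff_outside)
  qed (use R H in auto)
  then show ?thesis by (simp add: surf_int_def mult.assoc)
qed

lemma momentum_identity:
  assumes R: "R > 0" "2 * R + 1 \<le> K" "2 * R + H \<le> M"
  defines "V \<equiv> \<lambda>x. (P x \<bullet> P x / 2) *\<^sub>R vert - (P x \<bullet> vert) *\<^sub>R P x"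
  shows "box_int K M (\<lambda>x. cutoff_grad R x \<bullet> V x)
       = surf_int K (\<lambda>p x. cutoff R p * (V p \<bullet> (- gradient \<eta> x, 1)))"
proof -
  let ?F = "\<lambda>x. cutoff R x *\<^sub>R V x"
  define V' where "V' x v = (Hess x v \<bullet> P x) *\<^sub>R vert
      - ((P x \<bullet> vert) *\<^sub>R Hess x v + (Hess x v \<bullet> vert) *\<^sub>R P x)" for x v
  let ?F' = "\<lambda>x v. cutoff R x *\<^sub>R V' x v + (cutoff_grad R x \<bullet> v) *\<^sub>R V x"
  have V'_div: "(\<Sum>b\<in>Basis. V' x b \<bullet> b) = 0" if x: "x \<in> fluid_domain \<eta>" for x
  proof -
    have "(\<Sum>b\<in>Basis. V' x b \<bullet> b) = (\<Sum>b\<in>Basis. (vert \<bullet> b) * (Hess x b \<bullet> P x)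
        - (P x \<bullet> vert) * (Hess x b \<bullet> b) - (P x \<bullet> b) * (Hess x b \<bullet> vert))"
      unfolding V'_def by (intro sum.cong) (simp_all add: inner_diff_left inner_add_left algebra_simps)
    also have "\<dots> = (\<Sum>b\<in>Basis. (vert \<bullet> b) * (Hess x b \<bullet> P x))
        - (P x \<bullet> vert) * (\<Sum>b\<in>Basis. Hess x b \<bullet> b) - (\<Sum>b\<in>Basis. (P x \<bullet> b) * (Hess x b \<bullet> vert))"
      by (simp only: sum_subtractf sum_distrib_left)
    also have "(\<Sum>b\<in>Basis. (vert \<bullet> b) * (Hess x b \<bullet> P x)) = (\<Sum>b\<in>Basis. if b = vert then Hess x b \<bullet> P x else 0)"
      by (intro sum.cong) (auto simp: inner_Basis)
    also have "\<dots> = Hess x vert \<bullet> P x" by simp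
    \<comment> \<open>Symmetry of the Hessian: the vertical derivative of |P|^2/2 equals the
      derivative of the vertical component of P in direction P.\<close>
    also have "\<dots> = (\<Sum>b\<in>Basis. (P x \<bullet> b) * (Hess x b \<bullet> vert))"
      by (subst euclidean_inner, intro sum.cong) (simp_all add: Hess_sym[OF x] mult.commute)
    finally show ?thesis by (simp add: Hess_trace[OF x])
  qed
  have "box_int K M (\<lambda>x. cutoff_grad R x \<bullet> V x)
     = integral (cube K) (\<lambda>x. ?F (x, \<eta> x) \<bullet> (- gradient \<eta> x, 1))"
    unfolding box_int_def
  proof (rule divergence_below_graph[OF \<eta>_C2, where F="?F" and F'="?F'"])
    show "(?F has_derivative ?F' x) (at x)" if "x \<in> fluid_domain \<eta>" for x
    proof (intro has_derivative_scaleR cutoff_has_derivative)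
      note P = P_deriv[OF that]
      have "((\<lambda>x. (1/2) * (P x \<bullet> P x)) has_derivative (\<lambda>v. (1/2) * (P x \<bullet> Hess x v + Hess x v \<bullet> P x))) (at x)"
        by (intro has_derivative_mult_right has_derivative_inner P)
      then have "((\<lambda>x. P x \<bullet> P x / 2) has_derivative (\<lambda>v. Hess x v \<bullet> P x)) (at x)"
        by (simp add: inner_commute)
      from has_derivative_diff[OF has_derivative_scaleR_left[OF this]
          has_derivative_scaleR[OF has_derivative_inner_left[OF P] P]]
      show "(V has_derivative V' x) (at x)"
        by (simp only: V_def V'_def[abs_def])
    qed
    have V_cont: "continuous_on S V" if "continuous_on S P" for S
      unfolding V_def divide_inverse by (intro continuous_intros that)
    show "continuous_on (fluid_domain \<eta>) (\<lambda>x. ?F' x v)" for v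
      unfolding V'_def
      by (intro continuous_intros V_cont continuous_on_domain continuous_on_cutoff continuous_on_cutoff_grad Hess_cont)
    show "continuous_on (closure (fluid_domain \<eta>)) ?F"
      by (intro continuous_intros V_cont P_cont continuous_on_cutoff)
    show "continuous_on (closure (fluid_domain \<eta>)) (\<lambda>x. cutoff_grad R x \<bullet> V x)"
      by (intro continuous_intros V_cont P_cont continuous_on_cutoff_grad)
    show "cutoff_grad R x \<bullet> V x = (\<Sum>b\<in>Basis. ?F' x b \<bullet> b)" if "x \<in> fluid_domain \<eta>" for x
    proof -
      have "(\<Sum>b\<in>Basis. ?F' x b \<bullet> b) = cutoff R x * (\<Sum>b\<in>Basis. V' x b \<bullet> b)
          + (\<Sum>b\<in>Basis. (cutoff_grad R x \<bullet> b) * (V x \<bullet> b))"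
        by (simp add: inner_add_left sum.distrib sum_distrib_left)
      then show ?thesis by (simp only: V'_div[OF that] euclidean_inner[symmetric] mult_zero_right add_0)
    qed
    show "?F x = 0" if "2 * R \<le> norm x" for x
      using that R by (simp add: cutoff_outside)
  qed (use R H in auto)
  then show ?thesis by (simp add: surf_int_def)
qed

end

lemma integral_derivative_eq_0:
  fixes h :: "'a::euclidean_space \<Rightarrow> real"
  assumes h: "\<And>x. (h has_derivative h' x) (at x)"
    and cont: "\<And>b. b \<in> Basis \<Longrightarrow> continuous_on UNIV (\<lambda>x. h' x b)"
    and supp: "\<And>x. norm x \<ge> r \<Longrightarrow> h x = 0" and K: "r + 1 \<le> K"
  shows "integral (cube K) (\<lambda>x. h' x v) = 0"
proof -
  have eq: "h' x v = (\<Sum>b\<in>Basis. (v \<bullet> b) * h' x b)" for x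
  proof -
    have "h' x v = h' x (\<Sum>b\<in>Basis. (v \<bullet> b) *\<^sub>R b)" by (simp only: euclidean_representation)
    also have "\<dots> = (\<Sum>b\<in>Basis. (v \<bullet> b) *\<^sub>R h' x b)"
      using has_derivative_linear[OF h[of x]] by (simp only: linear_sum linear_cmul)
    finally show ?thesis by simp
  qed
  have int: "(\<lambda>x. h' x b) integrable_on cube K" if "b \<in> Basis" for b
    unfolding cube_def by (intro integrable_continuous continuous_on_subset[OF cont[OF that]]) simp
  have "integral (cube K) (\<lambda>x. h' x v) = (\<Sum>b\<in>Basis. integral (cube K) (\<lambda>x. (v \<bullet> b) * h' x b))"
    unfolding eq by (rule integral_sum) (simp_all add: integrable_on_mult_right int)
  also have "\<dots> = 0"
    by (intro sum.neutral ballI)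
      (simp add: integral_directional_derivative_eq_0[OF h _ cont supp K])
  finally show ?thesis .
qed

section \<open>Integration by parts along the surface\<close>

context deep_water
begin

lemma surface_deriv: "((\<lambda>x. (x, \<eta> x + s)) has_derivative (\<lambda>v. (v, gradient \<eta> x \<bullet> v))) (at x)"
proof -
  have "(\<eta> has_derivative (\<lambda>v. gradient \<eta> x \<bullet> v)) (at x)"
    by (rule C2_on_gradient(1)[OF \<eta>_C2]) simp
  then have "((\<lambda>x. \<eta> x + s) has_derivative (\<lambda>v. gradient \<eta> x \<bullet> v)) (at x)"
    by (rule has_derivative_add_const)
  then show ?thesis by (intro has_derivative_Pair has_derivative_ident)
qed

lemma surface_cont: "continuous_on S (\<lambda>x. (x, \<eta> x))"
  by (intro continuous_intros \<eta>_cont)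

lemma cutoff_surface:
  assumes "R > 0" "2 * R \<le> norm x"
  shows "cutoff R (x, z) = 0" "cutoff_grad R (x, z) = 0"
  using cutoff_outside[OF assms(1), of "(x, z)"] assms(2) norm_fst_le[where x=x and y=z] by auto

text \<open>
  As \<open>\<phi>\<close> is differentiable only in the open domain, the identity is obtained on the translates of
  the surface by \<open>s < 0\<close> first, and then in the limit \<open>s \<rightarrow> 0\<close>.
\<close>

lemma tangential_identity:
  assumes R: "R > 0" "2 * R + 1 \<le> K"
  shows "surf_int K (\<lambda>p x. cutoff R p * (P p \<bullet> (v, gradient \<eta> x \<bullet> v))
      + (cutoff_grad R p \<bullet> (v, gradient \<eta> x \<bullet> v)) * \<phi> p) = 0"
proof -
  define h' where "h' s x v = cutoff R (x, \<eta> x + s) * (P (x, \<eta> x + s) \<bullet> (v, gradient \<eta> x \<bullet> v))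
      + (cutoff_grad R (x, \<eta> x + s) \<bullet> (v, gradient \<eta> x \<bullet> v)) * \<phi> (x, \<eta> x + s)" for s x v
  define G where "G s = integral (cube K) (\<lambda>x. h' s x v)" for s
  have h'_cont: "continuous_on ({..0} \<times> B) (\<lambda>p. h' (fst p) (snd p) v)" for v B
  proof -
    have g: "continuous_on ({..0} \<times> B) (\<lambda>p. gradient \<eta> (snd p))"
      by (rule continuous_on_compose2[OF grad_\<eta>_cont[of UNIV]]) (auto intro!: continuous_intros)
    have *: "continuous_on ({..0} \<times> B) (\<lambda>p. f (snd p, \<eta> (snd p) + fst p))"
      if "continuous_on (closure (fluid_domain \<eta>)) f" for f :: "'a \<times> real \<Rightarrow> 'b::topological_space"
      by (rule continuous_on_subset[OF continuous_on_flatten[OF \<eta>_cont that]]) auto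
    show ?thesis
      unfolding h'_def
      by (intro continuous_on_add continuous_on_mult continuous_on_inner continuous_on_Pair
          continuous_on_const g *[OF continuous_on_cutoff] *[OF continuous_on_cutoff_grad] *[OF P_cont] *[OF \<phi>_cont])
  qed
  have "G s = 0" if s: "s < 0" for s
    unfolding G_def
  proof (rule integral_derivative_eq_0[where h="\<lambda>x. cutoff R (x, \<eta> x + s) * \<phi> (x, \<eta> x + s)" and r="2 * R"])
    have below: "(x, \<eta> x + s) \<in> fluid_domain \<eta>" for x
      using s by (simp add: fluid_domain_def)
    show "((\<lambda>x. cutoff R (x, \<eta> x + s) * \<phi> (x, \<eta> x + s)) has_derivative h' s x) (at x)" for x
      using has_derivative_mult[OF has_derivative_compose[OF surface_deriv cutoff_has_derivative]
          has_derivative_compose[OF surface_deriv \<phi>_deriv[OF below]]]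
      by (simp only: h'_def[abs_def])
    have "continuous_on UNIV (\<lambda>x. (s, x))" by (intro continuous_intros)
    then show "continuous_on UNIV (\<lambda>x. h' s x b)" for b
      using continuous_on_compose2[OF h'_cont[of UNIV b], of UNIV "\<lambda>x. (s, x)"] s
      by (simp add: image_subset_iff)
  qed (use R cutoff_surface in auto)
  moreover have "continuous_on {..0} G"
    unfolding G_def cube_def
    by (rule integral_continuous_on_param) (use h'_cont in \<open>simp add: split_beta\<close>)
  ultimately have "G 0 = 0"
    using continuous_constant_on_closure[of "{..<0}" G 0 0] by simp
  then show ?thesis
    by (simp add: G_def h'_def surf_int_def)
qed

text \<open>The product rule for q^(-1/2) (-\<nabla>\<eta>, 1): \<open>L\<close> is the Hessian of
  \<open>\<eta>\<close> applied to \<open>v\<close>, and q^(-1/2) has derivative -q^(-3/2)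
  (\<nabla>\<eta> \<bullet> L).\<close>

definition normal_deriv :: "'a \<Rightarrow> 'a \<Rightarrow> 'a \<times> real" where
  "normal_deriv x v =
    (let L = (\<Sum>b\<in>Basis. (gradient (partial_deriv b \<eta>) x \<bullet> v) *\<^sub>R b);
         q = 1 + gradient \<eta> x \<bullet> gradient \<eta> x
     in inverse (sqrt q) *\<^sub>R (- L, 0)
       + (- (inverse (sqrt q) * inverse q) * (gradient \<eta> x \<bullet> L)) *\<^sub>R (- gradient \<eta> x, 1))"

lemma unit_normal_deriv: "(unit_normal \<eta> has_derivative normal_deriv x) (at x)"
proof -
  define L where "L v = (\<Sum>b\<in>Basis. (gradient (partial_deriv b \<eta>) x \<bullet> v) *\<^sub>R b)" for v
  define q where "q x = 1 + gradient \<eta> x \<bullet> gradient \<eta> x" for x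
  have q: "q x > 0" for x by (simp add: q_def add_pos_nonneg)
  have "((\<lambda>x. \<Sum>b\<in>Basis. partial_deriv b \<eta> x *\<^sub>R b) has_derivative L) (at x)"
    unfolding L_def
    by (intro has_derivative_sum has_derivative_scaleR_left C2_on_gradient(2)[OF \<eta>_C2]) auto
  then have L: "(gradient \<eta> has_derivative L) (at x)"
    by (simp only: gradient_def[abs_def])
  have "(q has_derivative (\<lambda>v. gradient \<eta> x \<bullet> L v + L v \<bullet> gradient \<eta> x)) (at x)"
    unfolding q_def using has_derivative_add[OF has_derivative_const has_derivative_inner[OF L L]] by simp
  then have "(q has_derivative (\<lambda>v. 2 * (gradient \<eta> x \<bullet> L v))) (at x)"
    by (simp add: inner_commute)
  moreover have "((\<lambda>t. inverse (sqrt t)) has_real_derivative - (inverse (sqrt (q x)) * inverse (q x)) / 2) (at (q x))"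
    using q[of x] by (auto intro!: derivative_eq_intros simp: power2_eq_square field_simps)
  ultimately have "((\<lambda>y. inverse (sqrt (q y))) has_derivative
      (\<lambda>v. - (inverse (sqrt (q x)) * inverse (q x)) / 2 * (2 * (gradient \<eta> x \<bullet> L v)))) (at x)"
    unfolding has_field_derivative_def by (rule has_derivative_compose)
  then have "((\<lambda>y. inverse (sqrt (q y)) *\<^sub>R (- gradient \<eta> y, 1::real)) has_derivative
      (\<lambda>v. inverse (sqrt (q x)) *\<^sub>R (- L v, 0) +
        (- (inverse (sqrt (q x)) * inverse (q x)) / 2 * (2 * (gradient \<eta> x \<bullet> L v))) *\<^sub>R (- gradient \<eta> x, 1))) (at x)"
    by (intro has_derivative_scaleR has_derivative_Pair has_derivative_minus L has_derivative_const)
  moreover have "unit_normal \<eta> = (\<lambda>y. inverse (sqrt (q y)) *\<^sub>R (- gradient \<eta> y, 1))"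
    by (simp add: unit_normal_def fun_eq_iff q_def power2_norm_eq_inner inverse_eq_divide)
  moreover have "normal_deriv x = (\<lambda>v. inverse (sqrt (q x)) *\<^sub>R (- L v, 0) +
        (- (inverse (sqrt (q x)) * inverse (q x)) / 2 * (2 * (gradient \<eta> x \<bullet> L v))) *\<^sub>R (- gradient \<eta> x, 1))"
    by (simp add: normal_deriv_def fun_eq_iff Let_def q_def L_def)
  ultimately show ?thesis by (simp only:)
qed

lemma normal_deriv_cont: "continuous_on UNIV (\<lambda>x. normal_deriv x v)"
proof -
  have "1 + gradient \<eta> x \<bullet> gradient \<eta> x \<noteq> 0" for x
    using inner_ge_zero[of "gradient \<eta> x"] by linarith
  then have "1 + gradient \<eta> x \<bullet> gradient \<eta> x \<noteq> 0" "sqrt (1 + gradient \<eta> x \<bullet> gradient \<eta> x) \<noteq> 0" for x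
    by simp_all
  then show ?thesis
    unfolding normal_deriv_def Let_def
    by (intro continuous_intros grad_\<eta>_cont C2_on_continuous_gradient(3)[OF \<eta>_C2]) auto
qed

lemma div_normal_eq: "div_normal \<eta> p = (\<Sum>b\<in>Basis. normal_deriv (fst p) b \<bullet> (b, 0))"
proof -
  have "((\<lambda>y. unit_normal \<eta> (fst y) \<bullet> b) has_derivative (\<lambda>v. normal_deriv (fst p) (fst v) \<bullet> b)) (at p)" for b
    by (intro has_derivative_inner_left has_derivative_compose[OF has_derivative_fst[OF has_derivative_ident] unit_normal_deriv])
  then have *: "partial_deriv u (\<lambda>y. unit_normal \<eta> (fst y) \<bullet> b) p = normal_deriv (fst p) (fst u) \<bullet> b" for u b
    by (rule partial_deriv_eq)
  \<comment> \<open>The vertical basis vector has horizontal part 0, so it contributes nothing to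
    the divergence.\<close>
  have "normal_deriv x 0 = 0" for x
    using linear_0[OF has_derivative_linear[OF unit_normal_deriv]] .
  then show ?thesis
    unfolding div_normal_def divergence_def * by (simp add: sum_Basis_Pair_real)
qed

text \<open>The sum over \<open>b\<close> of the integrals of the \<open>b\<close>-derivative of
  \<chi> N_b, where \<chi> is the cutoff restricted to the surface and N_b a horizontal component of
  the normal. Both factors are differentiable on the surface itself, so no translates are
  involved.\<close>

lemma curvature_identity:
  assumes R: "R > 0" "2 * R + 1 \<le> K"
  shows "surf_int K (\<lambda>p x. cutoff R p * div_normal \<eta> p
     + cutoff_grad R p \<bullet> (fst (unit_normal \<eta> x), gradient \<eta> x \<bullet> fst (unit_normal \<eta> x))) = 0"
proof -
  define h' where "h' b x v = cutoff R (x, \<eta> x) * (normal_deriv x v \<bullet> (b, 0))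
      + (cutoff_grad R (x, \<eta> x) \<bullet> (v, gradient \<eta> x \<bullet> v)) * (unit_normal \<eta> x \<bullet> (b, 0))" for b x v
  have N_cont: "continuous_on UNIV (unit_normal \<eta>)"
    by (intro continuous_at_imp_continuous_on ballI has_derivative_continuous[OF unit_normal_deriv])
  have h'_cont: "continuous_on UNIV (\<lambda>x. h' b x v)" for b v
    unfolding h'_def
    by (intro continuous_on_add continuous_on_mult continuous_on_inner continuous_on_Pair
          continuous_on_const grad_\<eta>_cont N_cont normal_deriv_cont
          continuous_on_compose2[OF continuous_on_cutoff surface_cont]
          continuous_on_compose2[OF continuous_on_cutoff_grad surface_cont]) auto
  have 0: "integral (cube K) (\<lambda>x. h' b x b) = 0" for b
  proof (rule integral_derivative_eq_0[where h="\<lambda>x. cutoff R (x, \<eta> x) * (unit_normal \<eta> x \<bullet> (b, 0))" and h'="h' b" and r="2 * R"])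
    show "((\<lambda>x. cutoff R (x, \<eta> x) * (unit_normal \<eta> x \<bullet> (b, 0))) has_derivative h' b x) (at x)" for x
      using has_derivative_mult[OF has_derivative_compose[OF surface_deriv[of 0, simplified] cutoff_has_derivative]
          has_derivative_inner_left[OF unit_normal_deriv]]
      by (simp only: h'_def[abs_def])
  qed (use R cutoff_surface h'_cont in auto)
  have int: "(\<lambda>x. h' b x b) integrable_on cube K" for b
    unfolding cube_def by (intro integrable_continuous continuous_on_subset[OF h'_cont]) simp
  have eq: "cutoff R (x, \<eta> x) * div_normal \<eta> (x, \<eta> x)
     + cutoff_grad R (x, \<eta> x) \<bullet> (fst (unit_normal \<eta> x), gradient \<eta> x \<bullet> fst (unit_normal \<eta> x)) = (\<Sum>b\<in>Basis. h' b x b)" for x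
  proof -
    let ?n = "fst (unit_normal \<eta> x)" and ?c = "cutoff_grad R (x, \<eta> x)"
    have "(\<Sum>b\<in>Basis. h' b x b) = cutoff R (x, \<eta> x) * div_normal \<eta> (x, \<eta> x)
       + (\<Sum>b\<in>Basis. (?c \<bullet> (b, gradient \<eta> x \<bullet> b)) * (?n \<bullet> b))"
      by (simp add: h'_def div_normal_eq sum.distrib sum_distrib_left inner_prod_def)
    moreover have "(\<Sum>b\<in>Basis. (?c \<bullet> (b, gradient \<eta> x \<bullet> b)) * (?n \<bullet> b))
       = (\<Sum>b\<in>Basis. (fst ?c \<bullet> b) * (?n \<bullet> b)) + snd ?c * (\<Sum>b\<in>Basis. (gradient \<eta> x \<bullet> b) * (?n \<bullet> b))"
      by (simp only: inner_prod_def fst_conv snd_conv inner_real_def distrib_right sum.distrib sum_distrib_left mult.assoc)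
    ultimately show ?thesis
      by (simp only: euclidean_inner[symmetric]) (simp add: inner_prod_def)
  qed
  show ?thesis
    unfolding surf_int_def eq by (subst integral_sum) (simp_all add: int 0)
qed

end

section \<open>Estimates\<close>

context deep_water
begin

section \<open>Basic properties of \<open>box_int\<close> and \<open>surf_int\<close>\<close>

lemma flat_integrable:
  assumes "continuous_on (closure (fluid_domain \<eta>)) f"
  shows "(\<lambda>p. f (fst p, \<eta> (fst p) + snd p) :: real) integrable_on cbox (- (K *\<^sub>R One), - M) (K *\<^sub>R One, 0)"
proof (rule integrable_continuous, rule continuous_on_compose2[OF assms])
  show "continuous_on (cbox (- (K *\<^sub>R One), - M) (K *\<^sub>R One, 0)) (\<lambda>p. (fst p, \<eta> (fst p) + snd p))"
    by (intro continuous_intros continuous_on_compose2[OF \<eta>_cont[of UNIV]]) auto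
  show "(\<lambda>p. (fst p, \<eta> (fst p) + snd p)) ` cbox (- (K *\<^sub>R One), - M) (K *\<^sub>R One, 0) \<subseteq> closure (fluid_domain \<eta>)"
    by (auto intro!: in_closure_fluid_domain simp: cbox_Pair_eq)
qed

lemma box_int_mono:
  assumes f: "continuous_on (closure (fluid_domain \<eta>)) f" and h: "continuous_on (closure (fluid_domain \<eta>)) h"
    and le: "\<And>x. x \<in> closure (fluid_domain \<eta>) \<Longrightarrow> f x \<le> h x"
  shows "box_int K M f \<le> box_int K M h"
  unfolding box_int_def
proof (rule integral_le[OF flat_integrable[OF f] flat_integrable[OF h]])
  fix p assume "p \<in> cbox (- (K *\<^sub>R One :: 'a), - M) (K *\<^sub>R One, 0)"
  then have "snd p \<le> 0" by (cases p) (simp add: cbox_Pair_eq)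
  then show "f (fst p, \<eta> (fst p) + snd p) \<le> h (fst p, \<eta> (fst p) + snd p)"
    by (intro le in_closure_fluid_domain)
qed

lemma box_int_mult: "box_int K M (\<lambda>x. c * f x) = c * box_int K M f"
  by (simp add: box_int_def)

lemma box_int_diff_const:
  assumes f: "continuous_on (closure (fluid_domain \<eta>)) f" and "K \<ge> 0" "M \<ge> 0"
  shows "box_int K M (\<lambda>x. f x - c) = box_int K M f - c * ((2 * K) ^ DIM('a) * M)"
proof -
  have "box_int K M (\<lambda>x. f x - c) = box_int K M f - integral (cbox (- (K *\<^sub>R One :: 'a), - M) (K *\<^sub>R One, 0)) (\<lambda>p. c)"
    unfolding box_int_def by (rule integral_diff[OF flat_integrable[OF f] integrable_const])
  also have "integral (cbox (- (K *\<^sub>R One :: 'a), - M) (K *\<^sub>R One, 0)) (\<lambda>p. c) = c * ((2 * K) ^ DIM('a) * M)"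
    unfolding integral_const content_Pair measure_cube[OF assms(2), unfolded cube_def]
    using assms(3) by simp
  finally show ?thesis .
qed

lemma on_surface_cont:
  fixes f :: "'a \<times> real \<Rightarrow> 'b::topological_space"
  assumes "continuous_on (closure (fluid_domain \<eta>)) f"
  shows "continuous_on UNIV (\<lambda>x. f (x, \<eta> x))"
proof (rule continuous_on_compose2[OF assms surface_cont])
  show "(\<lambda>x. (x, \<eta> x)) ` UNIV \<subseteq> closure (fluid_domain \<eta>)"
    using in_closure_fluid_domain[of 0 _ \<eta>] by (simp add: image_subset_iff)
qed

lemma cutoff_surface_cont:
  "continuous_on UNIV (\<lambda>x. cutoff R (x, \<eta> x))" "continuous_on UNIV (\<lambda>x. cutoff_grad R (x, \<eta> x))"
  by (rule on_surface_cont, rule continuous_on_cutoff, rule on_surface_cont, rule continuous_on_cutoff_grad)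

lemmas surface_values_cont = on_surface_cont[OF \<phi>_cont] on_surface_cont[OF P_cont]

lemma cube_integrable: "continuous_on UNIV f \<Longrightarrow> (f :: 'a \<Rightarrow> real) integrable_on cube K"
  unfolding cube_def by (rule integrable_continuous) (erule continuous_on_subset, simp)

lemma surf_int_bound:
  assumes "continuous_on UNIV (\<lambda>x. f (x, \<eta> x) x)" "continuous_on UNIV h"
    and "\<And>x. \<bar>f (x, \<eta> x) x\<bar> \<le> h x"
  shows "\<bar>surf_int K f\<bar> \<le> integral (cube K) h"
  unfolding surf_int_def
  using integral_norm_bound_integral[OF cube_integrable cube_integrable, OF assms(1,2)] assms(3) by simp

lemma surf_int_add:
  assumes "continuous_on UNIV (\<lambda>x. f (x, \<eta> x) x)" "continuous_on UNIV (\<lambda>x. h (x, \<eta> x) x)"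
  shows "surf_int K (\<lambda>p x. f p x + h p x) = surf_int K f + surf_int K h"
  unfolding surf_int_def by (rule integral_add[OF cube_integrable[OF assms(1)] cube_integrable[OF assms(2)]])

lemma surf_int_mult: "surf_int K (\<lambda>p x. c * f p x) = c * surf_int K f"
  by (simp add: surf_int_def)

definition energy :: "real \<Rightarrow> real \<Rightarrow> real \<Rightarrow> real" where
  "energy R K M = box_int K M (\<lambda>x. cutoff R x * (P x \<bullet> P x))"

text \<open>The gradient of the cutoff is at most (8/R) sqrt \<chi>, so the product is at most (sqrt
  \<chi> |p|) (8\<kappa>/R), and Young's inequality splits it; 32 is 64/2. Inside radius R the
  gradient vanishes, so \<bar>t\<bar> has to be bounded only outside.\<close>

lemma cutoff_young:
  fixes p :: "'b::euclidean_space"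
  assumes R: "R > 0" and \<kappa>: "\<kappa> \<ge> 0" "R \<le> norm x \<Longrightarrow> \<bar>t\<bar> \<le> \<kappa>"
  shows "\<bar>t * (cutoff_grad R x \<bullet> p)\<bar> \<le> cutoff R x * (p \<bullet> p) / 2 + 32 * \<kappa>\<^sup>2 / R\<^sup>2"
proof (cases "R \<le> norm x")
  case True
  define s where "s = sqrt (cutoff R x)"
  have s: "0 \<le> s" "s\<^sup>2 = cutoff R x" by (simp_all add: s_def cutoff_bounds)
  have "(norm (cutoff_grad R x))\<^sup>2 \<le> (8 / R * s)\<^sup>2"
    using cutoff_grad_square_le(1)[OF R, of x] by (simp add: power_mult_distrib power_divide s(2))
  then have d: "norm (cutoff_grad R x) \<le> 8 / R * s"
    by (rule power2_le_imp_le) (use R s in simp)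
  have "\<bar>t * (cutoff_grad R x \<bullet> p)\<bar> \<le> \<kappa> * (norm (cutoff_grad R x) * norm p)"
    unfolding abs_mult by (intro mult_mono \<kappa>(2) True Cauchy_Schwarz_ineq2) (use \<kappa> in auto)
  also have "\<dots> \<le> \<kappa> * (8 / R * s * norm p)"
    by (intro mult_left_mono mult_right_mono d \<kappa>) auto
  also have "\<dots> = (s * norm p) * (8 * \<kappa> / R)" by simp
  also have "\<dots> \<le> ((s * norm p)\<^sup>2 + (8 * \<kappa> / R)\<^sup>2) / 2"
    using sum_squares_bound[of "s * norm p" "8 * \<kappa> / R"] by simp
  also have "\<dots> = cutoff R x * (p \<bullet> p) / 2 + 32 * \<kappa>\<^sup>2 / R\<^sup>2"
    by (simp add: power_mult_distrib power_divide s(2) power2_norm_eq_inner add_divide_distrib)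
  finally show ?thesis .
next
  case False
  then show ?thesis using cutoff_inside(2)[OF R, of x] cutoff_bounds[of R x] by simp
qed

text \<open>The Caccioppoli estimate: \<open>cutoff_young\<close> absorbs half of the energy in
  \<open>energy_identity\<close>, which accounts for the factor 2. The kinematic condition replaces
  the normal derivative in the surface term by -(a \<bullet> \<nabla>\<eta>), so that term is
  bounded independently of R.\<close>

lemma energy_le:
  assumes kin: "\<And>x. P (x, \<eta> x) \<bullet> (- gradient \<eta> x, 1) = - (a \<bullet> gradient \<eta> x)"
    and C: "\<And>x. \<bar>\<phi> (x, \<eta> x)\<bar> \<le> C" and L: "integral (cube K) (\<lambda>x. norm (gradient \<eta> x)) \<le> L"
    and R: "R > 0" "2 * R + 1 \<le> K" "2 * R + H \<le> M"
    and \<kappa>: "\<kappa> \<ge> 0" "\<And>x. x \<in> closure (fluid_domain \<eta>) \<Longrightarrow> R \<le> norm x \<Longrightarrow> \<bar>\<phi> x\<bar> \<le> \<kappa>"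
  shows "energy R K M \<le> 2 * (C * norm a * L) + 64 * \<kappa>\<^sup>2 / R\<^sup>2 * ((2 * K) ^ DIM('a) * M)"
proof -
  have C0: "C \<ge> 0" using C[of 0] by linarith
  have M0: "M \<ge> 0" using H[of 0] R by linarith
  have K0: "K \<ge> 0" using R by linarith
  let ?e = "\<lambda>x. (1/2) * (cutoff R x * (P x \<bullet> P x))"
  have ce: "continuous_on (closure (fluid_domain \<eta>)) (\<lambda>x. cutoff R x * (P x \<bullet> P x))"
    by (intro continuous_on_mult continuous_on_inner continuous_on_cutoff P_cont)
  have ce2: "continuous_on (closure (fluid_domain \<eta>)) ?e"
    by (intro continuous_on_mult[OF continuous_on_const] ce)
  have "energy R K M / 2 - 32 * \<kappa>\<^sup>2 / R\<^sup>2 * ((2 * K) ^ DIM('a) * M)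
      = box_int K M (\<lambda>x. ?e x - 32 * \<kappa>\<^sup>2 / R\<^sup>2)"
    unfolding box_int_diff_const[OF ce2 K0 M0] box_int_mult energy_def by simp
  also have "\<dots> \<le> box_int K M (\<lambda>x. \<phi> x * (cutoff_grad R x \<bullet> P x) + cutoff R x * (P x \<bullet> P x))"
  proof (rule box_int_mono)
    fix x assume x: "x \<in> closure (fluid_domain \<eta>)"
    show "?e x - 32 * \<kappa>\<^sup>2 / R\<^sup>2 \<le> \<phi> x * (cutoff_grad R x \<bullet> P x) + cutoff R x * (P x \<bullet> P x)"
      using cutoff_young[where x=x and p="P x", OF R(1) \<kappa>(1) \<kappa>(2)[OF x]] unfolding abs_le_iff by linarith
  qed (intro continuous_on_diff continuous_on_add continuous_on_mult continuous_on_inner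
      ce2 ce \<phi>_cont P_cont continuous_on_cutoff_grad continuous_on_const)+
  also have "\<dots> = surf_int K (\<lambda>p x. cutoff R p * \<phi> p * (P p \<bullet> (- gradient \<eta> x, 1)))"
    by (rule energy_identity[OF R])
  also have "\<dots> \<le> \<bar>\<dots>\<bar>" by simp
  also have "\<dots> \<le> integral (cube K) (\<lambda>x. (C * norm a) * norm (gradient \<eta> x))"
  proof (rule surf_int_bound[where f="\<lambda>p x. cutoff R p * \<phi> p * (P p \<bullet> (- gradient \<eta> x, 1))"])
    show "continuous_on UNIV (\<lambda>x. cutoff R (x, \<eta> x) * \<phi> (x, \<eta> x) * (P (x, \<eta> x) \<bullet> (- gradient \<eta> x, 1)))"
      by (intro continuous_on_mult continuous_on_inner continuous_on_Pair continuous_on_minus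
          continuous_on_const cutoff_surface_cont grad_\<eta>_cont surface_values_cont)
    show "\<bar>cutoff R (x, \<eta> x) * \<phi> (x, \<eta> x) * (P (x, \<eta> x) \<bullet> (- gradient \<eta> x, 1))\<bar> \<le> C * norm a * norm (gradient \<eta> x)" for x
    proof -
      have "\<bar>cutoff R (x, \<eta> x) * \<phi> (x, \<eta> x) * (P (x, \<eta> x) \<bullet> (- gradient \<eta> x, 1))\<bar>
          = \<bar>cutoff R (x, \<eta> x)\<bar> * \<bar>\<phi> (x, \<eta> x)\<bar> * \<bar>a \<bullet> gradient \<eta> x\<bar>"
        by (simp add: abs_mult kin)
      also have "\<dots> \<le> 1 * C * (norm a * norm (gradient \<eta> x))"
        by (intro mult_mono C Cauchy_Schwarz_ineq2) (use cutoff_bounds[of R "(x, \<eta> x)"] C0 in auto)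
      finally show ?thesis by (simp add: mult.assoc)
    qed
  qed (intro continuous_intros grad_\<eta>_cont)
  also have "\<dots> = C * norm a * integral (cube K) (\<lambda>x. norm (gradient \<eta> x))" by simp
  also have "\<dots> \<le> C * norm a * L"
    by (intro mult_left_mono L) (use C0 in simp)
  finally show ?thesis by (simp add: algebra_simps)
qed

definition stress :: "'a \<times> real \<Rightarrow> 'a \<times> real" where
  "stress x = (P x \<bullet> P x / 2) *\<^sub>R vert - (P x \<bullet> vert) *\<^sub>R P x"

lemma stress_cont:
  "continuous_on S P \<Longrightarrow> continuous_on S stress"
  unfolding stress_def[abs_def] divide_inverse by (intro continuous_intros)

lemma norm_stress: "norm (stress x) \<le> 3/2 * (P x \<bullet> P x)"
proof -
  have "norm (stress x) \<le> norm ((P x \<bullet> P x / 2) *\<^sub>R (vert :: 'a \<times> real)) + norm ((P x \<bullet> vert) *\<^sub>R P x)"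
    unfolding stress_def by (rule norm_triangle_ineq4)
  also have "\<dots> = P x \<bullet> P x / 2 + \<bar>P x \<bullet> vert\<bar> * norm (P x)"
    by (simp add: norm_Basis)
  also have "\<bar>P x \<bullet> vert\<bar> * norm (P x) \<le> norm (P x) * norm (P x)"
    by (intro mult_right_mono Basis_le_norm) auto
  finally show ?thesis by (simp add: power2_norm_eq_inner[symmetric] power2_eq_square)
qed

text \<open>The gradient of \<open>cutoff R\<close> lives where |x| \<le> 2R, and there
  \<open>cutoff (2 * R)\<close> equals 1, so the energy at scale 2R controls the quadratic field.
  The constant is 8 from the cutoff times 3/2 from \<open>norm_stress\<close>.\<close>

lemma momentum_le:
  assumes R: "R > 0" "4 * R + 1 \<le> K" "4 * R + H \<le> M"
  shows "\<bar>surf_int K (\<lambda>p x. cutoff R p * (stress p \<bullet> (- gradient \<eta> x, 1)))\<bar> \<le> 12 / R * energy (2 * R) K M"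
proof -
  have eq: "surf_int K (\<lambda>p x. cutoff R p * (stress p \<bullet> (- gradient \<eta> x, 1))) = box_int K M (\<lambda>x. cutoff_grad R x \<bullet> stress x)"
    unfolding stress_def by (rule momentum_identity[symmetric]) (use R in auto)
  have le: "\<bar>cutoff_grad R x \<bullet> stress x\<bar> \<le> 12 / R * (cutoff (2 * R) x * (P x \<bullet> P x))" for x
  proof (cases "norm x \<le> 2 * R")
    case True
    have "\<bar>cutoff_grad R x \<bullet> stress x\<bar> \<le> norm (cutoff_grad R x) * norm (stress x)"
      by (rule Cauchy_Schwarz_ineq2)
    also have "\<dots> \<le> 8 / R * (3/2 * (P x \<bullet> P x))"
      by (intro mult_mono cutoff_grad_square_le norm_stress) (use R in auto)
    finally show ?thesis using True R cutoff_inside[of "2 * R" x] by simp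
  next
    case False
    then show ?thesis using R cutoff_outside[of R x] cutoff_bounds[of "2 * R" x] by simp
  qed
  have c1: "continuous_on (closure (fluid_domain \<eta>)) (\<lambda>x. cutoff_grad R x \<bullet> stress x)"
    by (intro continuous_on_inner continuous_on_cutoff_grad stress_cont P_cont)
  have c2: "continuous_on (closure (fluid_domain \<eta>)) (\<lambda>x. c * (cutoff (2 * R) x * (P x \<bullet> P x)))" for c
    by (intro continuous_on_mult[OF continuous_on_const] continuous_on_mult continuous_on_inner continuous_on_cutoff P_cont)
  have "box_int K M (\<lambda>x. cutoff_grad R x \<bullet> stress x) \<le> box_int K M (\<lambda>x. 12 / R * (cutoff (2 * R) x * (P x \<bullet> P x)))"
    by (rule box_int_mono[OF c1 c2]) (use le in \<open>auto simp: abs_le_iff\<close>)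
  moreover have "box_int K M (\<lambda>x. - (12 / R) * (cutoff (2 * R) x * (P x \<bullet> P x))) \<le> box_int K M (\<lambda>x. cutoff_grad R x \<bullet> stress x)"
  proof (rule box_int_mono[OF c2 c1])
    fix x
    show "- (12 / R) * (cutoff (2 * R) x * (P x \<bullet> P x)) \<le> cutoff_grad R x \<bullet> stress x"
      using le[of x] unfolding abs_le_iff by linarith
  qed
  ultimately show ?thesis
    unfolding eq box_int_mult energy_def by (simp add: abs_le_iff)
qed

text \<open>By \<open>tangential_identity\<close> the derivative moves onto the cutoff, whose
  gradient is at most 8/R and vanishes inside radius R. The last factor is the volume of the cube,
  so \<kappa> must be smaller than K^d/R is large, with d = \<open>DIM('a)\<close>.\<close>

lemma tangential_le:
  assumes R: "R > 0" "2 * R + 1 \<le> K" and G: "\<And>x. norm (gradient \<eta> x) \<le> G"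
    and \<kappa>: "\<kappa> \<ge> 0" "\<And>x. R \<le> norm (x, \<eta> x) \<Longrightarrow> \<bar>\<phi> (x, \<eta> x)\<bar> \<le> \<kappa>"
  shows "\<bar>surf_int K (\<lambda>p x. cutoff R p * (P p \<bullet> (a, gradient \<eta> x \<bullet> a)))\<bar>
      \<le> 8 / R * (norm a * (1 + G)) * \<kappa> * (2 * K) ^ DIM('a)"
proof -
  have G0: "G \<ge> 0" using G[of 0] norm_ge_zero order_trans by blast
  let ?f = "\<lambda>p x. cutoff R p * (P p \<bullet> (a, gradient \<eta> x \<bullet> a))"
  let ?h = "\<lambda>p x. (cutoff_grad R p \<bullet> (a, gradient \<eta> x \<bullet> a)) * \<phi> p"
  have ca: "continuous_on UNIV (\<lambda>x. (a, gradient \<eta> x \<bullet> a))"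
    by (intro continuous_intros grad_\<eta>_cont)
  have c1: "continuous_on UNIV (\<lambda>x. cutoff R (x, \<eta> x) * (P (x, \<eta> x) \<bullet> (a, gradient \<eta> x \<bullet> a)))"
    and c2: "continuous_on UNIV (\<lambda>x. (cutoff_grad R (x, \<eta> x) \<bullet> (a, gradient \<eta> x \<bullet> a)) * \<phi> (x, \<eta> x))"
    by (intro continuous_on_mult continuous_on_inner ca cutoff_surface_cont surface_values_cont)+
  have "surf_int K (\<lambda>p x. cutoff R p * (P p \<bullet> (a, gradient \<eta> x \<bullet> a)))
      = - surf_int K (\<lambda>p x. (cutoff_grad R p \<bullet> (a, gradient \<eta> x \<bullet> a)) * \<phi> p)"
    using tangential_identity[OF R, of a] surf_int_add[where f="?f" and h="?h", OF c1 c2, of K] by simp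
  also have "\<bar>\<dots>\<bar> \<le> integral (cube K :: 'a set) (\<lambda>x. 8 / R * (norm a * (1 + G)) * \<kappa>)"
    unfolding abs_minus_cancel
  proof (rule surf_int_bound[where f="?h", OF c2])
    fix x
    let ?v = "(a, gradient \<eta> x \<bullet> a)"
    have "norm ?v \<le> norm a + \<bar>gradient \<eta> x \<bullet> a\<bar>"
      using norm_Pair_le[of a "gradient \<eta> x \<bullet> a"] by simp
    also have "\<bar>gradient \<eta> x \<bullet> a\<bar> \<le> G * norm a"
      by (rule order_trans[OF Cauchy_Schwarz_ineq2]) (intro mult_right_mono G, simp)
    finally have v: "norm ?v \<le> norm a * (1 + G)" by (simp add: algebra_simps)
    show "\<bar>cutoff_grad R (x, \<eta> x) \<bullet> ?v * \<phi> (x, \<eta> x)\<bar> \<le> 8 / R * (norm a * (1 + G)) * \<kappa>"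
    proof (cases "R \<le> norm (x, \<eta> x)")
      case True
      have "\<bar>cutoff_grad R (x, \<eta> x) \<bullet> ?v\<bar> \<le> norm (cutoff_grad R (x, \<eta> x)) * norm ?v"
        by (rule Cauchy_Schwarz_ineq2)
      also have "\<dots> \<le> 8 / R * (norm a * (1 + G))"
        by (intro mult_mono cutoff_grad_square_le v) (use R in auto)
      finally show ?thesis
        unfolding abs_mult using R G0 by (intro mult_mono \<kappa>(2) True) auto
    next
      case False
      then show ?thesis using cutoff_inside(2)[of R "(x, \<eta> x)"] R G0 \<kappa>(1) by simp
    qed
  qed simp
  also have "\<dots> = 8 / R * (norm a * (1 + G)) * \<kappa> * (2 * K) ^ DIM('a)"
    using R measure_cube[of K, where 'a='a] by (simp add: cube_def)
  finally show ?thesis .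
qed

text \<open>The horizontal part of N is at most |\<nabla>\<eta>| in norm, so its integral stays
  bounded and the cutoff gradient provides the decay 1/R.\<close>

lemma curvature_le:
  assumes R: "R > 0" "2 * R + 1 \<le> K" and G: "\<And>x. norm (gradient \<eta> x) \<le> G"
    and L: "integral (cube K) (\<lambda>x. norm (gradient \<eta> x)) \<le> L"
  shows "\<bar>surf_int K (\<lambda>p x. cutoff R p * div_normal \<eta> p)\<bar> \<le> 8 / R * (1 + G) * L"
proof -
  have G0: "G \<ge> 0" using G[of 0] norm_ge_zero order_trans by blast
  have N_cont: "continuous_on UNIV (unit_normal \<eta>)"
    by (intro continuous_at_imp_continuous_on ballI has_derivative_continuous[OF unit_normal_deriv])
  let ?n = "\<lambda>x. fst (unit_normal \<eta> x)"
  let ?f = "\<lambda>p x. cutoff R p * div_normal \<eta> p"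
  let ?h = "\<lambda>p x. cutoff_grad R p \<bullet> (?n x, gradient \<eta> x \<bullet> ?n x)"
  have cd: "continuous_on UNIV (\<lambda>x. div_normal \<eta> (x, \<eta> x))"
    unfolding div_normal_eq fst_conv by (intro continuous_intros normal_deriv_cont)
  have cv: "continuous_on UNIV (\<lambda>x. (?n x, gradient \<eta> x \<bullet> ?n x))"
    by (intro continuous_intros grad_\<eta>_cont N_cont)
  have c1: "continuous_on UNIV (\<lambda>x. cutoff R (x, \<eta> x) * div_normal \<eta> (x, \<eta> x))"
    and c2: "continuous_on UNIV (\<lambda>x. cutoff_grad R (x, \<eta> x) \<bullet> (?n x, gradient \<eta> x \<bullet> ?n x))"
    by (intro continuous_on_mult continuous_on_inner cv cd cutoff_surface_cont)+
  have "surf_int K (\<lambda>p x. cutoff R p * div_normal \<eta> p)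
      = - surf_int K (\<lambda>p x. cutoff_grad R p \<bullet> (?n x, gradient \<eta> x \<bullet> ?n x))"
    using curvature_identity[OF R] surf_int_add[where f="?f" and h="?h", OF c1 c2, of K] by simp
  also have "\<bar>\<dots>\<bar> \<le> integral (cube K) (\<lambda>x. (8 / R * (1 + G)) * norm (gradient \<eta> x))"
    unfolding abs_minus_cancel
  proof (rule surf_int_bound[where f="?h", OF c2])
    fix x
    let ?v = "(?n x, gradient \<eta> x \<bullet> ?n x)"
    have n: "norm (?n x) \<le> norm (gradient \<eta> x)"
    proof -
      have "norm (?n x) = norm (gradient \<eta> x) / sqrt (1 + (norm (gradient \<eta> x))\<^sup>2)"
        by (simp add: unit_normal_def)
      also have "\<dots> \<le> norm (gradient \<eta> x) / 1"
        by (intro divide_left_mono) (auto simp: add_pos_nonneg)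
      finally show ?thesis by simp
    qed
    have "norm ?v \<le> norm (?n x) + \<bar>gradient \<eta> x \<bullet> ?n x\<bar>"
      using norm_Pair_le[of "?n x" "gradient \<eta> x \<bullet> ?n x"] by simp
    also have "\<bar>gradient \<eta> x \<bullet> ?n x\<bar> \<le> G * norm (?n x)"
      by (rule order_trans[OF Cauchy_Schwarz_ineq2]) (intro mult_right_mono G, simp)
    also have "norm (?n x) + G * norm (?n x) = (1 + G) * norm (?n x)" by (simp add: algebra_simps)
    also have "\<dots> \<le> (1 + G) * norm (gradient \<eta> x)"
      by (intro mult_left_mono n) (use G0 in simp)
    finally have v: "norm ?v \<le> (1 + G) * norm (gradient \<eta> x)" by simp
    have "\<bar>cutoff_grad R (x, \<eta> x) \<bullet> ?v\<bar> \<le> norm (cutoff_grad R (x, \<eta> x)) * norm ?v"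
      by (rule Cauchy_Schwarz_ineq2)
    also have "\<dots> \<le> 8 / R * ((1 + G) * norm (gradient \<eta> x))"
      by (intro mult_mono cutoff_grad_square_le v) (use R in auto)
    finally show "\<bar>cutoff_grad R (x, \<eta> x) \<bullet> ?v\<bar> \<le> (8 / R * (1 + G)) * norm (gradient \<eta> x)" by (simp only: mult.assoc)
  qed (intro continuous_intros grad_\<eta>_cont)
  also have "\<dots> = 8 / R * (1 + G) * integral (cube K) (\<lambda>x. norm (gradient \<eta> x))" by simp
  also have "\<dots> \<le> 8 / R * (1 + G) * L"
    by (intro mult_left_mono L) (use R G0 in simp)
  finally show ?thesis .
qed

end

section \<open>Integrability of decaying functions\<close>

text \<open>Continuity turns the asymptotic bound into a global one; \<open>max 1 (norm x)\<close>
  removes the singularity at the origin.\<close>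

lemma decay_bound:
  fixes f :: "'a::euclidean_space \<Rightarrow> real"
  assumes cont: "continuous_on UNIV f" and O: "f \<in> O[at_infinity](\<lambda>x. 1 / norm x powr p)" and p: "p > 0"
  obtains B where "B \<ge> 0" "\<And>x. \<bar>f x\<bar> \<le> B * (1 / max 1 (norm x) powr p)"
proof -
  obtain c where c: "c > 0" "\<forall>\<^sub>F x in at_infinity. norm (f x) \<le> c * norm (1 / norm x powr p)"
    using O by (rule landau_o.bigE)
  then obtain r where r: "\<And>x. r \<le> norm x \<Longrightarrow> norm (f x) \<le> c * norm (1 / norm x powr p)"
    unfolding eventually_at_infinity by blast
  define s where "s = max 1 r"
  have "bounded (f ` cball 0 s)"
    by (intro compact_imp_bounded compact_continuous_image continuous_on_subset[OF cont]) auto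
  then obtain b where b: "b > 0" "\<And>x. x \<in> cball 0 s \<Longrightarrow> norm (f x) \<le> b"
    unfolding bounded_pos by blast
  have s: "s powr p > 0" by (simp add: s_def)
  show thesis
  \<comment> \<open>Beyond radius \<open>s\<close> the asymptotic constant \<open>c\<close> works.
    Inside, the bound \<open>b\<close> must be multiplied by \<open>s powr p\<close>, because the
    comparison function is only at least \<open>1 / s powr p\<close> there.\<close>
  proof (rule that[of "c + b * s powr p"])
    show "0 \<le> c + b * s powr p" using c b s by simp
    fix x :: 'a
    have m: "1 / max 1 (norm x) powr p > 0" by simp
    show "\<bar>f x\<bar> \<le> (c + b * s powr p) * (1 / max 1 (norm x) powr p)"
    proof (cases "norm x \<le> s")
      case True
      have "\<bar>f x\<bar> \<le> b * 1" using b True by simp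
      also have "1 \<le> s powr p * (1 / max 1 (norm x) powr p)"
        using True p by (simp add: s_def powr_mono2)
      then have "b * 1 \<le> b * (s powr p * (1 / max 1 (norm x) powr p))"
        using b by (intro mult_left_mono) auto
      also have "\<dots> \<le> (c + b * s powr p) * (1 / max 1 (norm x) powr p)"
        using c m unfolding distrib_right mult.assoc by simp
      finally show ?thesis .
    next
      case False
      then have "max 1 (norm x) = norm x" "r \<le> norm x" by (auto simp: s_def)
      then have "\<bar>f x\<bar> \<le> c * (1 / max 1 (norm x) powr p)" using r by simp
      also have "\<dots> \<le> (c + b * s powr p) * (1 / max 1 (norm x) powr p)"
        using b s m by (intro mult_right_mono) auto
      finally show ?thesis .
    qed
  qed
qed

text \<open>A dyadic majorant of |x|^(-p). The k-th cube has side 4 * 2^k, so with d =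
  \<open>DIM('a)\<close> its layer has integral 4^d 2^(-k(p-d)), a convergent geometric series
  because p > d.\<close>

lemma integrable_cube_layers:
  assumes p: "p > real DIM('a::euclidean_space)"
  defines "h \<equiv> \<lambda>k x. (1 / (2 ^ k) powr p) * indicator (cube (2 ^ Suc k) :: 'a set) x :: real"
  shows "integrable lborel (\<lambda>x. \<Sum>k. h k x)" "summable (\<lambda>k. h k x)"
proof -
  have geo: "summable (\<lambda>k. 1 / (2 ^ k) powr q)" if "q > 0" for q :: real
  proof -
    have "2 powr - q < 2 powr (0::real)" using that by (intro powr_less_mono) auto
    then have "summable (\<lambda>k. (2 powr - q) ^ k)" by (intro summable_geometric) simp
    moreover have "(2 powr - q) ^ k = 1 / (2 ^ k) powr q" for k
    proof -
      have "(2 ^ k) powr q = (2 powr q) ^ k"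
        by (simp add: powr_realpow[symmetric] powr_powr powr_power mult.commute)
      then show ?thesis by (simp add: powr_minus power_inverse divide_inverse)
    qed
    ultimately show ?thesis by simp
  qed
  have p0: "p > 0" using p by (rule le_less_trans[rotated]) simp
  have h0: "norm (h k x) \<le> 1 / (2 ^ k) powr p" for k x
    by (auto simp: h_def indicator_def)
  show sm: "summable (\<lambda>k. h k x)" for x
    by (rule summable_comparison_test'[OF geo[OF p0] h0])
  have meas: "cube K \<in> sets lborel" "emeasure lborel (cube K :: 'a set) < \<infinity>" for K
    unfolding cube_def by (simp, rule emeasure_bounded_finite, rule bounded_cbox)
  have int: "integrable lborel (h k)" for k
    unfolding h_def by (intro integrable_mult_right integrable_real_indicator meas)
  have norm_h: "(\<integral>x. norm (h k x) \<partial>lborel) = 4 ^ DIM('a) * (1 / (2 ^ k) powr (p - DIM('a)))" for k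
  proof -
    have "(\<integral>x. norm (h k x) \<partial>lborel) = (1 / (2 ^ k) powr p) * measure lborel (cube (2 ^ Suc k) :: 'a set)"
      using meas by (simp add: h_def)
    also have "measure lborel (cube (2 ^ Suc k) :: 'a set) = 4 ^ DIM('a) * (2 ^ k) ^ DIM('a)"
    proof -
      have "measure lborel (cube (2 ^ Suc k) :: 'a set) = (2 * 2 ^ Suc k) ^ DIM('a)"
        by (rule measure_cube) simp
      also have "2 * 2 ^ Suc k = 4 * (2 ^ k :: real)" by simp
      finally show ?thesis by (simp only: power_mult_distrib)
    qed
    also have "(2 ^ k) ^ DIM('a) = ((2 ^ k) powr DIM('a) :: real)"
      by (simp add: powr_realpow)
    finally show ?thesis by (simp add: powr_diff)
  qed
  have sm2: "summable (\<lambda>k. \<integral>x. norm (h k x) \<partial>lborel)"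
    unfolding norm_h using p by (intro summable_mult geo) simp
  have "AE x in lborel. summable (\<lambda>k. norm (h k x))"
    using sm by (simp add: h_def)
  from integrable_suminf[OF int this sm2] show "integrable lborel (\<lambda>x. \<Sum>k. h k x)" .
qed

lemma integrable_decay:
  fixes f :: "'a::euclidean_space \<Rightarrow> real"
  assumes cont: "continuous_on UNIV f" and O: "f \<in> O[at_infinity](\<lambda>x. 1 / norm x powr p)"
    and p: "p > real DIM('a)"
  shows "integrable lborel f"
proof -
  have p0: "p > 0" using p by (rule le_less_trans[rotated]) simp
  obtain B where B: "B \<ge> 0" "\<And>x. \<bar>f x\<bar> \<le> B * (1 / max 1 (norm x) powr p)"
    using decay_bound[OF cont O p0] by blast
  define h where "h = (\<lambda>k x. (1 / (2 ^ k) powr p) * indicator (cube (2 ^ Suc k) :: 'a set) x :: real)"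
  have h: "integrable lborel (\<lambda>x. \<Sum>k. h k x)" "summable (\<lambda>k. h k x)" for x
    unfolding h_def by (rule integrable_cube_layers[OF p])+
  show ?thesis
  proof (rule Bochner_Integration.integrable_bound)
    show "integrable lborel (\<lambda>x. B * (\<Sum>k. h k x))"
      by (intro integrable_mult_right h)
    show "f \<in> borel_measurable lborel"
      using borel_measurable_continuous_onI[OF cont] by simp
    show "AE x in lborel. norm (f x) \<le> norm (B * (\<Sum>k. h k x))"
    proof (rule AE_I2)
      fix x :: 'a
      let ?m = "max 1 (norm x)"
      \<comment> \<open>With this choice 2^k \<le> \<open>?m\<close> < 2^(k+1): the point lies in
        the k-th cube, and that single layer already dominates \<open>1 / ?m powr p\<close>.\<close>
      define k where "k = nat \<lfloor>log 2 ?m\<rfloor>"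
      have l: "0 \<le> log 2 ?m" by simp
      have k: "real k \<le> log 2 ?m" "log 2 ?m < real k + 1"
        using l unfolding k_def by linarith+
      have e: "2 powr (log 2 ?m) = ?m" by (rule powr_log_cancel) auto
      have "2 powr real k \<le> 2 powr (log 2 ?m)" using k(1) by (rule powr_mono) simp
      moreover have "2 powr (log 2 ?m) < 2 powr (real k + 1)" using k(2) by (rule powr_less_mono) simp
      ultimately have m: "2 ^ k \<le> ?m" "?m < 2 ^ Suc k"
        unfolding e by (simp_all only: powr_realpow powr_add powr_one power_Suc mult.commute zero_less_numeral)
      have "x \<in> cube (2 ^ Suc k)" by (intro norm_le_imp_cube) (use m in simp)
      then have hk: "h k x = 1 / (2 ^ k) powr p" by (simp add: h_def)
      have "1 / ?m powr p \<le> 1 / (2 ^ k) powr p"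
        using m p0 by (intro divide_left_mono powr_mono2) auto
      also have "\<dots> = h k x" by (simp add: hk)
      also have "\<dots> \<le> (\<Sum>k. h k x)"
        using sum_le_suminf[OF h(2), of "{k}"] by (simp add: h_def)
      finally have "1 / ?m powr p \<le> (\<Sum>k. h k x)" .
      then have "B * (1 / ?m powr p) \<le> B * (\<Sum>k. h k x)"
        by (intro mult_left_mono B)
      with B(2)[of x] show "norm (f x) \<le> norm (B * (\<Sum>k. h k x))" by simp
    qed
  qed
qed

section \<open>Assembling the estimates and passing to the limit\<close>

context deep_water
begin

lemma mass_bound:
  assumes kin: "\<And>x. P (x, \<eta> x) \<bullet> (- gradient \<eta> x, 1) = - (a \<bullet> gradient \<eta> x)"
    and bern: "\<And>x. P (x, \<eta> x) \<bullet> P (x, \<eta> x) / 2 - (a, 0) \<bullet> P (x, \<eta> x) + g * \<eta> x = - \<sigma> * div_normal \<eta> (x, \<eta> x)"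
    and g: "g \<ge> 0" and dim: "DIM('a) \<le> 2"
    and C: "\<And>x. \<bar>\<phi> (x, \<eta> x)\<bar> \<le> C" and G: "\<And>x. norm (gradient \<eta> x) \<le> G"
    and L: "\<And>K. integral (cube K) (\<lambda>x. norm (gradient \<eta> x)) \<le> L"
    and R: "1 \<le> R" "H \<le> R"
    and \<kappa>: "\<kappa> \<ge> 0" "\<And>x. x \<in> closure (fluid_domain \<eta>) \<Longrightarrow> R \<le> norm x \<Longrightarrow> \<bar>\<phi> x\<bar> * norm x ^ (DIM('a) - 1) \<le> \<kappa>"
  shows "g * \<bar>surf_int (4 * R + 1) (\<lambda>p x. cutoff R p * \<eta> x)\<bar>
     \<le> (8 * \<bar>\<sigma>\<bar> * (1 + G) * L + 24 * (C * norm a * L)) / R + 96000 * \<kappa>\<^sup>2 + 800 * (norm a * (1 + G)) * \<kappa>"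
proof -
  \<comment> \<open>The energy enters at scale 2R, whose cutoff reaches radius 4R. Since 1 \<le> R
    and H \<le> R, this gives 2K \<le> 10R and M \<le> 5R.\<close>
  define K where "K = 4 * R + 1"
  define M where "M = 4 * R + H"
  have H0: "H \<ge> 0" using H[of 0] by linarith
  have G0: "G \<ge> 0" using G[of 0] norm_ge_zero order_trans by blast
  have K: "(2 * K) ^ DIM('a) \<le> (10 * R) ^ DIM('a)"
    using R by (intro power_mono) (auto simp: K_def)
  have "(10 * R) ^ DIM('a) \<le> (10 * R)\<^sup>2"
    using R dim by (intro power_increasing) auto
  with K have K2: "(2 * K) ^ DIM('a) \<le> 100 * R\<^sup>2" by (simp add: power_mult_distrib)
  \<comment> \<open>For the energy a plain bound on \<bar>\<phi>\<bar> is enough; since R \<ge> 1,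
    the power of the norm is at least 1.\<close>
  have \<kappa>1: "\<bar>\<phi> x\<bar> \<le> \<kappa>" if "x \<in> closure (fluid_domain \<eta>)" "R \<le> norm x" for x
  proof -
    have "\<bar>\<phi> x\<bar> * 1 \<le> \<bar>\<phi> x\<bar> * norm x ^ (DIM('a) - 1)"
      using that R by (intro mult_left_mono one_le_power) auto
    also have "\<dots> \<le> \<kappa>" by (rule \<kappa>(2)[OF that])
    finally show ?thesis by simp
  qed
  have \<kappa>2: "\<bar>\<phi> (x, \<eta> x)\<bar> \<le> \<kappa> / R ^ (DIM('a) - 1)" if "R \<le> norm (x, \<eta> x)" for x
  proof -
    have "\<bar>\<phi> (x, \<eta> x)\<bar> * R ^ (DIM('a) - 1) \<le> \<bar>\<phi> (x, \<eta> x)\<bar> * norm (x, \<eta> x) ^ (DIM('a) - 1)"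
      using that R by (intro mult_left_mono power_mono) auto
    also have "\<dots> \<le> \<kappa>"
      using \<kappa>(2)[OF _ that] in_closure_fluid_domain[of 0 x \<eta>] by simp
    finally show ?thesis using R by (simp add: pos_le_divide_eq)
  qed
  let ?E = "energy (2 * R) K M"
  have "?E \<le> 2 * (C * norm a * L) + 64 * \<kappa>\<^sup>2 / (2 * R)\<^sup>2 * ((2 * K) ^ DIM('a) * M)"
    by (rule energy_le[OF kin C L]) (use R \<kappa>(1) \<kappa>1 in \<open>auto simp: K_def M_def\<close>)
  \<comment> \<open>Here 64/4 * 100 * 5 = 8000; the factor 12/R of \<open>momentum_le\<close> later
    turns 8000 R into 96000.\<close>
  also have "64 * \<kappa>\<^sup>2 / (2 * R)\<^sup>2 * ((2 * K) ^ DIM('a) * M) \<le> 64 * \<kappa>\<^sup>2 / (2 * R)\<^sup>2 * ((100 * R\<^sup>2) * (5 * R))"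
    using R H0 by (intro mult_left_mono mult_mono K2) (auto simp: M_def)
  also have "\<dots> = 8000 * \<kappa>\<^sup>2 * R"
    using R by (simp add: power_mult_distrib power2_eq_square)
  finally have E: "?E \<le> 2 * (C * norm a * L) + 8000 * \<kappa>\<^sup>2 * R" by simp
  have I1: "\<bar>surf_int K (\<lambda>p x. cutoff R p * (stress p \<bullet> (- gradient \<eta> x, 1)))\<bar>
      \<le> 24 * (C * norm a * L) / R + 96000 * \<kappa>\<^sup>2" (is "\<bar>?I1\<bar> \<le> _")
  proof -
    have "\<bar>?I1\<bar> \<le> 12 / R * ?E"
      by (rule momentum_le) (use R in \<open>auto simp: K_def M_def\<close>)
    also have "\<dots> \<le> 12 / R * (2 * (C * norm a * L) + 8000 * \<kappa>\<^sup>2 * R)"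
      using R by (intro mult_left_mono E) auto
    also have "\<dots> = 24 * (C * norm a * L) / R + 96000 * \<kappa>\<^sup>2"
      using R by (simp add: distrib_left)
    finally show ?thesis .
  qed
  have I2: "\<bar>surf_int K (\<lambda>p x. cutoff R p * (P p \<bullet> (a, gradient \<eta> x \<bullet> a)))\<bar> \<le> 800 * (norm a * (1 + G)) * \<kappa>"
    (is "\<bar>?I2\<bar> \<le> _")
  proof -
    have "\<bar>?I2\<bar> \<le> 8 / R * (norm a * (1 + G)) * (\<kappa> / R ^ (DIM('a) - 1)) * (2 * K) ^ DIM('a)"
      by (rule tangential_le[OF _ _ G _ \<kappa>2]) (use R \<kappa>(1) in \<open>auto simp: K_def\<close>)
    \<comment> \<open>The decay of \<phi> supplies R^(d-1) in the denominator, which together with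
      the 1/R of the cutoff exactly balances the volume R^d of the cube. The 100 bounds 10^d for d
      \<le> 2.\<close>
    also have "\<dots> \<le> 8 / R * (norm a * (1 + G)) * (\<kappa> / R ^ (DIM('a) - 1)) * (100 * (R * R ^ (DIM('a) - 1)))"
    proof (rule mult_left_mono)
      have "(10::real) ^ DIM('a) \<le> 10\<^sup>2" using dim by (intro power_increasing) auto
      then have "(10 * R) ^ DIM('a) \<le> 100 * R ^ DIM('a)"
        using R by (simp add: power_mult_distrib)
      moreover have "R ^ DIM('a) = R * R ^ (DIM('a) - 1)"
        by (simp flip: power_Suc)
      ultimately show "(2 * K) ^ DIM('a) \<le> 100 * (R * R ^ (DIM('a) - 1))" using K by simp
    qed (use R G0 \<kappa>(1) in simp)
    also have "\<dots> = 800 * (norm a * (1 + G)) * \<kappa>"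
      using R by simp
    finally show ?thesis .
  qed
  have I3: "\<bar>surf_int K (\<lambda>p x. cutoff R p * div_normal \<eta> p)\<bar> \<le> 8 / R * (1 + G) * L" (is "\<bar>?I3\<bar> \<le> _")
    by (rule curvature_le[OF _ _ G L]) (use R in \<open>auto simp: K_def\<close>)
  let ?f1 = "\<lambda>p x. cutoff R p * (stress p \<bullet> (- gradient \<eta> x, 1))"
  let ?f2 = "\<lambda>p x. cutoff R p * (P p \<bullet> (a, gradient \<eta> x \<bullet> a))"
  let ?f3 = "\<lambda>p x. cutoff R p * div_normal \<eta> p"
  have cg: "continuous_on UNIV (\<lambda>x. (- gradient \<eta> x, 1::real))" "continuous_on UNIV (\<lambda>x. (a, gradient \<eta> x \<bullet> a))"
    by (intro continuous_intros grad_\<eta>_cont)+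
  have cd: "continuous_on UNIV (\<lambda>x. div_normal \<eta> (x, \<eta> x))"
    unfolding div_normal_eq fst_conv by (intro continuous_intros normal_deriv_cont)
  have c: "continuous_on UNIV (\<lambda>x. ?f1 (x, \<eta> x) x)" "continuous_on UNIV (\<lambda>x. ?f2 (x, \<eta> x) x)"
    "continuous_on UNIV (\<lambda>x. ?f3 (x, \<eta> x) x)"
    by (intro continuous_on_mult continuous_on_inner cg cd cutoff_surface_cont surface_values_cont
        on_surface_cont[OF stress_cont[OF P_cont]])+
  have pointwise: "g * (cutoff R (x, \<eta> x) * \<eta> x) = - \<sigma> * ?f3 (x, \<eta> x) x + (- 1 * ?f1 (x, \<eta> x) x + ?f2 (x, \<eta> x) x)" for x
  proof -
    let ?p = "P (x, \<eta> x)"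
    have "stress (x, \<eta> x) \<bullet> (- gradient \<eta> x, 1) = ?p \<bullet> ?p / 2 + snd ?p * (a \<bullet> gradient \<eta> x)"
      unfolding stress_def inner_diff_left inner_scaleR_left kin
      by (simp add: vert_def inner_prod_def)
    moreover have "?p \<bullet> (a, gradient \<eta> x \<bullet> a) = (a, 0) \<bullet> ?p + snd ?p * (a \<bullet> gradient \<eta> x)"
      by (simp add: inner_prod_def inner_commute)
    moreover have "g * \<eta> x = - \<sigma> * div_normal \<eta> (x, \<eta> x) - ?p \<bullet> ?p / 2 + (a, 0) \<bullet> ?p"
      using bern[of x] by linarith
    ultimately have "g * \<eta> x = - \<sigma> * div_normal \<eta> (x, \<eta> x) - stress (x, \<eta> x) \<bullet> (- gradient \<eta> x, 1) + ?p \<bullet> (a, gradient \<eta> x \<bullet> a)"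
      by linarith
    then have "cutoff R (x, \<eta> x) * (g * \<eta> x) = cutoff R (x, \<eta> x) * (- \<sigma> * div_normal \<eta> (x, \<eta> x) - stress (x, \<eta> x) \<bullet> (- gradient \<eta> x, 1) + ?p \<bullet> (a, gradient \<eta> x \<bullet> a))"
      by (simp only:)
    then show ?thesis by (simp add: algebra_simps)
  qed
  have "g * surf_int K (\<lambda>p x. cutoff R p * \<eta> x) = surf_int K (\<lambda>p x. - \<sigma> * ?f3 p x + (- 1 * ?f1 p x + ?f2 p x))"
    unfolding surf_int_mult[symmetric] unfolding surf_int_def pointwise ..
  also have "\<dots> = surf_int K (\<lambda>p x. - \<sigma> * ?f3 p x) + surf_int K (\<lambda>p x. - 1 * ?f1 p x + ?f2 p x)"
    by (rule surf_int_add[where f="\<lambda>p x. - \<sigma> * ?f3 p x" and h="\<lambda>p x. - 1 * ?f1 p x + ?f2 p x"])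
      (intro continuous_on_add continuous_on_mult[OF continuous_on_const] c)+
  also have "surf_int K (\<lambda>p x. - 1 * ?f1 p x + ?f2 p x) = surf_int K (\<lambda>p x. - 1 * ?f1 p x) + ?I2"
    by (rule surf_int_add[where f="\<lambda>p x. - 1 * ?f1 p x" and h="?f2"])
      (intro continuous_on_mult[OF continuous_on_const] c)+
  finally have eq: "g * surf_int K (\<lambda>p x. cutoff R p * \<eta> x) = - \<sigma> * ?I3 + (- 1 * ?I1 + ?I2)"
    unfolding surf_int_mult .
  have "\<bar>\<sigma> * ?I3\<bar> \<le> \<bar>\<sigma>\<bar> * (8 / R * (1 + G) * L)"
    unfolding abs_mult by (intro mult_left_mono I3) simp
  with I1 I2 have "\<bar>g * surf_int K (\<lambda>p x. cutoff R p * \<eta> x)\<bar>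
     \<le> \<bar>\<sigma>\<bar> * (8 / R * (1 + G) * L) + (24 * (C * norm a * L) / R + 96000 * \<kappa>\<^sup>2) + 800 * (norm a * (1 + G)) * \<kappa>"
    unfolding eq by linarith
  also have "\<dots> = (8 * \<bar>\<sigma>\<bar> * (1 + G) * L + 24 * (C * norm a * L)) / R + 96000 * \<kappa>\<^sup>2 + 800 * (norm a * (1 + G)) * \<kappa>"
    using R by (simp add: field_simps)
  finally show ?thesis
    using g by (simp add: K_def abs_mult)
qed

text \<open>Dominated convergence with majorant \<bar>\<eta>\<bar>. The radii \<open>Suc k\<close>
  are positive, and for each fixed point the cutoff is eventually 1.\<close>

lemma surf_int_tendsto:
  assumes int: "integrable lborel \<eta>"
  shows "(\<lambda>k. surf_int (4 * real (Suc k) + 1) (\<lambda>p x. cutoff (real (Suc k)) p * \<eta> x)) \<longlonglongrightarrow> (LINT x|lborel. \<eta> x)"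
proof -
  let ?s = "\<lambda>k x. cutoff (real (Suc k)) (x, \<eta> x) * \<eta> x"
  have meas: "?s k \<in> borel_measurable lborel" for k
    using borel_measurable_continuous_onI[OF continuous_on_mult[OF cutoff_surface_cont(1) \<eta>_cont]] by simp
  have bound: "norm (?s k x) \<le> norm (\<eta> x)" for k x
    using mult_right_mono[of "cutoff (real (Suc k)) (x, \<eta> x)" 1 "\<bar>\<eta> x\<bar>"] cutoff_bounds[of "real (Suc k)" "(x, \<eta> x)"]
    by (simp add: abs_mult)
  have "surf_int (4 * real (Suc k) + 1) (\<lambda>p x. cutoff (real (Suc k)) p * \<eta> x) = (LINT x|lborel. ?s k x)" for k
  proof -
    have "?s k x = 0" if "x \<notin> cube (4 * real (Suc k) + 1)" for x
      using that norm_le_imp_cube[of x "4 * real (Suc k) + 1"] cutoff_surface(1)[of "real (Suc k)" x "\<eta> x"] by force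
    then have "surf_int (4 * real (Suc k) + 1) (\<lambda>p x. cutoff (real (Suc k)) p * \<eta> x) = integral UNIV (?s k)"
      unfolding surf_int_def by (rule integral_superset_support)
    moreover have "integrable lborel (?s k)"
      by (rule Bochner_Integration.integrable_bound[OF int meas]) (use bound in simp)
    ultimately show ?thesis by (simp only: integral_lborel)
  qed
  moreover have "(\<lambda>k. LINT x|lborel. ?s k x) \<longlonglongrightarrow> (LINT x|lborel. \<eta> x)"
  proof (rule integral_dominated_convergence[where w="\<lambda>x. norm (\<eta> x)"])
    show "AE x in lborel. (\<lambda>k. ?s k x) \<longlonglongrightarrow> \<eta> x"
    proof (rule AE_I2)
      fix x
      obtain m where m: "norm (x, \<eta> x) \<le> real m" using real_arch_simple by blast
      have "\<forall>\<^sub>F k in sequentially. ?s k x = \<eta> x"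
        unfolding eventually_sequentially
      proof (intro exI[of _ m] allI impI)
        fix k assume "m \<le> k"
        then show "?s k x = \<eta> x" using m cutoff_inside(1)[of "real (Suc k)" "(x, \<eta> x)"] by simp
      qed
      then show "(\<lambda>k. ?s k x) \<longlonglongrightarrow> \<eta> x" by (rule tendsto_eventually)
    qed
  qed (use int meas bound in \<open>auto intro: integrable_norm\<close>)
  ultimately show ?thesis by simp
qed

text \<open>Two successive limits in \<open>mass_bound\<close>: first the radius tends to infinity
  with \<kappa> fixed, which removes the O(1/R) terms collected in \<open>Q\<close>, then \<kappa>
  tends to 0 in the remainder \<open>T \<kappa>\<close>.\<close>

lemma zero_mass:
  assumes kin: "\<And>x. P (x, \<eta> x) \<bullet> (- gradient \<eta> x, 1) = - (a \<bullet> gradient \<eta> x)"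
    and bern: "\<And>x. P (x, \<eta> x) \<bullet> P (x, \<eta> x) / 2 - (a, 0) \<bullet> P (x, \<eta> x) + g * \<eta> x = - \<sigma> * div_normal \<eta> (x, \<eta> x)"
    and g: "g > 0" and dim: "DIM('a) \<le> 2"
    and C: "\<And>x. \<bar>\<phi> (x, \<eta> x)\<bar> \<le> C" and G: "\<And>x. norm (gradient \<eta> x) \<le> G"
    and L: "\<And>K. integral (cube K) (\<lambda>x. norm (gradient \<eta> x)) \<le> L"
    and decay: "\<And>\<kappa>. \<kappa> > 0 \<Longrightarrow> \<exists>r. \<forall>x\<in>closure (fluid_domain \<eta>). r \<le> norm x \<longrightarrow> \<bar>\<phi> x\<bar> * norm x ^ (DIM('a) - 1) \<le> \<kappa>"
    and int: "integrable lborel \<eta>"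
  shows "(LINT x|lborel. \<eta> x) = 0"
proof -
  define Q where "Q = 8 * \<bar>\<sigma>\<bar> * (1 + G) * L + 24 * (C * norm a * L)"
  define T where "T \<kappa> = 96000 * \<kappa>\<^sup>2 + 800 * (norm a * (1 + G)) * \<kappa>" for \<kappa>
  let ?I = "\<lambda>k. surf_int (4 * real (Suc k) + 1) (\<lambda>p x. cutoff (real (Suc k)) p * \<eta> x)"
  let ?m = "g * \<bar>LINT x|lborel. \<eta> x\<bar>"
  have le: "?m \<le> T \<kappa>" if \<kappa>: "\<kappa> > 0" for \<kappa>
  proof -
    obtain r where r: "\<And>x. x \<in> closure (fluid_domain \<eta>) \<Longrightarrow> r \<le> norm x \<Longrightarrow> \<bar>\<phi> x\<bar> * norm x ^ (DIM('a) - 1) \<le> \<kappa>"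
      using decay[OF \<kappa>] by blast
    obtain m where m: "max r H \<le> real m" using real_arch_simple by blast
    have "g * \<bar>?I k\<bar> \<le> Q / real (Suc k) + T \<kappa>" if "m \<le> k" for k
    proof -
      have "max r H \<le> real (Suc k)" using m that by simp
      then have "g * \<bar>?I k\<bar> \<le> Q / real (Suc k) + 96000 * \<kappa>\<^sup>2 + 800 * (norm a * (1 + G)) * \<kappa>"
        unfolding Q_def using g \<kappa>
        by (intro mass_bound[OF kin bern _ dim C G L] r) auto
      then show ?thesis by (simp add: T_def)
    qed
    then have ev: "\<forall>\<^sub>F k in sequentially. g * \<bar>?I k\<bar> \<le> Q / real (Suc k) + T \<kappa>"
      unfolding eventually_sequentially by blast
    have lim1: "(\<lambda>k. g * \<bar>?I k\<bar>) \<longlonglongrightarrow> ?m"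
      by (intro tendsto_intros surf_int_tendsto int)
    have lim2: "(\<lambda>k. Q / real (Suc k) + T \<kappa>) \<longlonglongrightarrow> 0 + T \<kappa>"
      by (intro tendsto_add tendsto_const LIMSEQ_Suc[OF lim_const_over_n])
    show ?thesis
      using tendsto_le[OF trivial_limit_sequentially lim2 lim1 ev] by simp
  qed
  have "(T \<longlongrightarrow> 96000 * 0\<^sup>2 + 800 * (norm a * (1 + G)) * 0) (at_right 0)"
    unfolding T_def by (intro tendsto_intros)
  then have "(T \<longlongrightarrow> 0) (at_right 0)" by simp
  moreover have "\<forall>\<^sub>F \<kappa> in at_right 0. ?m \<le> T \<kappa>"
    unfolding eventually_at_right_field using le by (intro exI[of _ 1]) simp
  ultimately have "?m \<le> 0"
    by (intro tendsto_lowerbound) auto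
  then show ?thesis using g by (simp add: mult_le_0_iff)
qed

end

section \<open>Conclusion\<close>

lemma gradient_continuous_extension:
  fixes f :: "'a::euclidean_space \<Rightarrow> real"
  assumes ext: "\<And>b. b \<in> Basis \<Longrightarrow> extends_continuously U (partial_deriv b f)"
  obtains P where "continuous_on (closure U) P" "\<And>x. x \<in> U \<Longrightarrow> P x = gradient f x"
proof -
  have "\<forall>b. \<exists>F. b \<in> Basis \<longrightarrow> continuous_on (closure U) F \<and> (\<forall>x\<in>U. F x = partial_deriv b f x)"
    using ext unfolding extends_continuously_def by blast
  then obtain F where F: "\<And>b. b \<in> Basis \<Longrightarrow> continuous_on (closure U) (F b)"
    "\<And>b x. b \<in> Basis \<Longrightarrow> x \<in> U \<Longrightarrow> F b x = partial_deriv b f x"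
    by metis
  show thesis
  proof (rule that[of "\<lambda>x. \<Sum>b\<in>Basis. F b x *\<^sub>R b"])
    show "continuous_on (closure U) (\<lambda>x. \<Sum>b\<in>Basis. F b x *\<^sub>R b)"
      by (intro continuous_on_sum continuous_on_scaleR F continuous_on_const)
    show "(\<Sum>b\<in>Basis. F b x *\<^sub>R b) = gradient f x" if "x \<in> U" for x
      unfolding gradient_def using that by (intro sum.cong) (simp_all add: F(2))
  qed
qed

text \<open>At a point of the closure outside \<open>U\<close> the filter
  \<open>at x within U\<close> is nontrivial, so the \<open>Lim\<close> in the definition is the
  boundary value of any continuous extension. This translates the surface conditions into statements
  about \<open>P\<close>.\<close>

lemma gradient_closure_eq:
  assumes P: "continuous_on (closure U) P" "\<And>x. x \<in> U \<Longrightarrow> P x = gradient f x"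
    and x: "x \<in> closure U" "x \<notin> U"
  shows "gradient_closure U f x = P x"
  unfolding gradient_closure_def
proof (rule tendsto_Lim)
  show "at x within U \<noteq> bot"
    using x by (simp add: trivial_limit_within closure_def)
  have "(P \<longlongrightarrow> P x) (at x within closure U)"
    using P(1) x(1) by (simp add: continuous_on)
  then have "(P \<longlongrightarrow> P x) (at x within U)"
    by (rule tendsto_within_subset) (rule closure_subset)
  then show "(gradient f \<longlongrightarrow> P x) (at x within U)"
    by (rule Lim_transform_eventually) (simp add: eventually_at_filter P(2))
qed

theorem corollary4:
  fixes n :: nat
    and g \<sigma> \<epsilon> :: real
    and c' :: "real ^ 'm"
    and c :: "(real ^ 'm) \<times> real"
    and \<eta> :: "real ^ 'm \<Rightarrow> real"
    and \<phi> :: "(real ^ 'm) \<times> real \<Rightarrow> real"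
    and \<Omega> S :: "((real ^ 'm) \<times> real) set"
  assumes "n \<in> {2, 3}" and "CARD('m) = n - 1"
    and "g > 0" and "\<sigma> \<ge> 0"
    and "c = (c', 0)" and "c \<noteq> 0"
    and "C2_on UNIV \<eta>"
    and "\<Omega> = fluid_domain \<eta>" and "S = free_surface \<eta>"
    and "C2_closure \<Omega> \<phi>"
    and "\<forall>x\<in>\<Omega>. laplacian \<phi> x = 0"
    and "\<forall>x\<in>S. gradient_closure \<Omega> \<phi> x \<bullet> unit_normal \<eta> (fst x) = c \<bullet> unit_normal \<eta> (fst x)"
    and "\<forall>x\<in>S. (norm (gradient_closure \<Omega> \<phi> x))\<^sup>2 / 2 - c \<bullet> gradient_closure \<Omega> \<phi> x + g * \<eta> (fst x)
            = - \<sigma> * div_normal \<eta> x"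
    and "(\<eta> \<longlongrightarrow> 0) at_infinity"
    and "(\<phi> \<longlongrightarrow> 0) (at_infinity_in_closure \<Omega>)"
    and "(gradient_closure \<Omega> \<phi> \<longlongrightarrow> 0) (at_infinity_in_closure \<Omega>)"
    and "0 < \<epsilon>" and "\<epsilon> < 1"
    and "\<phi> \<in> o[at_infinity_in_closure \<Omega>](\<lambda>x. 1 / norm x ^ (n - 2))"
    and "\<eta> \<in> O[at_infinity](\<lambda>x'. 1 / norm x' powr (real n - 1 + \<epsilon>))"
    and "\<forall>i. partial_deriv (axis i 1) \<eta> \<in> O[at_infinity](\<lambda>x'. 1 / norm x' powr (real n + \<epsilon>))"
    and "\<forall>i j. partial_deriv (axis i 1) (partial_deriv (axis j 1) \<eta>)
            \<in> O[at_infinity](\<lambda>x'. 1 / norm x' powr (real n + 1 + \<epsilon>))"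
  shows "integrable lborel \<eta> \<and> (LINT x'|lborel. \<eta> x') = 0"
proof -
  have dim: "DIM(real ^ 'm) = n - 1" using assms(2) by simp
  have n: "n = 2 \<or> n = 3" using assms(1) by auto
  \<comment> \<open>In terms of d = n - 1 the decay exponents are d + \<epsilon> for \<eta> and d +
    1 + \<epsilon> for its first derivatives, both above the integrability threshold d.\<close>
  have real_n: "real n = real DIM(real ^ 'm) + 1" using n dim by auto
  have O_\<eta>: "\<eta> \<in> O[at_infinity](\<lambda>x'. 1 / norm x' powr (real DIM(real ^ 'm) + \<epsilon>))"
    using assms(20) by (simp add: real_n)
  have Basis_axis: "\<exists>i. b = axis i 1" if "b \<in> Basis" for b :: "real ^ 'm"
    using that by (auto simp: Basis_vec_def)
  have O_grad: "partial_deriv b \<eta> \<in> O[at_infinity](\<lambda>x'. 1 / norm x' powr (real DIM(real ^ 'm) + 1 + \<epsilon>))"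
    if "b \<in> Basis" for b
    using assms(21) Basis_axis[OF that] by (auto simp: real_n)
  note C2 = assms(7)
  have cont_\<eta>: "continuous_on UNIV \<eta>" and cont_grad: "continuous_on UNIV (gradient \<eta>)"
    using C2_on_continuous_gradient[OF C2] by blast+
  have cont_partial: "continuous_on UNIV (partial_deriv b \<eta>)" if "b \<in> Basis" for b
    using has_derivative_continuous[OF C2_on_gradient(2)[OF C2 _ that]]
    by (simp add: continuous_at_imp_continuous_on)
  have int: "integrable lborel \<eta>"
    by (rule integrable_decay[OF cont_\<eta> O_\<eta>]) (use assms(17) in simp)
  have int_partial: "integrable lborel (partial_deriv b \<eta>)" if "b \<in> Basis" for b
    by (rule integrable_decay[OF cont_partial O_grad, OF that that]) (use assms(17) in simp)
  have bounded: "\<exists>B. \<forall>x. \<bar>f x\<bar> \<le> B"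
    if f: "continuous_on UNIV f" "f \<in> O[at_infinity](\<lambda>x'. 1 / norm x' powr p)" "p > 0" for f :: "real ^ 'm \<Rightarrow> real" and p
  proof -
    obtain B where B: "B \<ge> 0" "\<And>x. \<bar>f x\<bar> \<le> B * (1 / max 1 (norm x) powr p)"
      using decay_bound[OF f] by blast
    have "\<bar>f x\<bar> \<le> B" for x
    proof -
      have "1 \<le> max 1 (norm x) powr p" by (rule ge_one_powr_ge_zero) (use f(3) in auto)
      then have "1 / max 1 (norm x) powr p \<le> 1" by simp
      then have "B * (1 / max 1 (norm x) powr p) \<le> B * 1" using B(1) by (rule mult_left_mono)
      then show ?thesis using B(2)[of x] by linarith
    qed
    then show ?thesis by blast
  qed
  obtain H where H: "\<And>x. \<bar>\<eta> x\<bar> \<le> H"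
    using bounded[OF cont_\<eta> O_\<eta>] assms(17) by auto
  \<comment> \<open>The l^1 norm of the gradient: it dominates the Euclidean norm and is a finite
    sum of integrable functions, so its total integral serves as \<open>L\<close> for all cubes at
    once.\<close>
  let ?A = "\<lambda>x. \<Sum>b\<in>Basis. \<bar>partial_deriv b \<eta> x\<bar>"
  have grad_le: "norm (gradient \<eta> x) \<le> ?A x" for x
    using norm_le_l1[of "gradient \<eta> x"] by (simp add: gradient_inner_Basis)
  have "\<forall>b\<in>Basis. \<exists>B. \<forall>x. \<bar>partial_deriv b \<eta> x\<bar> \<le> B"
    using bounded[OF cont_partial O_grad] assms(17) by auto
  then obtain B where B: "\<And>b x. b \<in> Basis \<Longrightarrow> \<bar>partial_deriv b \<eta> x\<bar> \<le> B b"
    by metis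
  have G: "norm (gradient \<eta> x) \<le> (\<Sum>b\<in>Basis. B b)" for x
    using grad_le[of x] sum_mono[of Basis "\<lambda>b. \<bar>partial_deriv b \<eta> x\<bar>" B] B by force
  have A_int: "integrable lborel ?A"
    by (intro Bochner_Integration.integrable_sum integrable_abs int_partial)
  have A_on: "?A integrable_on UNIV" by (rule integrable_on_lborel[OF A_int])
  have L: "integral (cube K) (\<lambda>x. norm (gradient \<eta> x)) \<le> integral UNIV ?A" for K
  proof -
    have A_cube: "?A integrable_on cube K"
      unfolding cube_def by (rule integrable_on_subcbox[OF A_on]) simp
    have "(\<lambda>x. norm (gradient \<eta> x)) integrable_on cube K"
      unfolding cube_def by (intro integrable_continuous continuous_on_norm continuous_on_subset[OF cont_grad]) simp
    then have "integral (cube K) (\<lambda>x. norm (gradient \<eta> x)) \<le> integral (cube K) ?A"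
      by (rule integral_le[OF _ A_cube grad_le])
    also have "\<dots> \<le> integral UNIV ?A"
      by (rule integral_subset_le[OF _ A_cube A_on]) (auto intro: sum_nonneg)
    finally show ?thesis .
  qed
  have \<Omega>: "\<Omega> = fluid_domain \<eta>" by (rule assms(8))
  have \<phi>: "C2_on \<Omega> \<phi>" "continuous_on (closure \<Omega>) \<phi>"
    "\<And>b. b \<in> Basis \<Longrightarrow> extends_continuously \<Omega> (partial_deriv b \<phi>)"
    using assms(10) unfolding C2_closure_def by auto
  obtain P where P: "continuous_on (closure \<Omega>) P" "\<And>x. x \<in> \<Omega> \<Longrightarrow> P x = gradient \<phi> x"
    using gradient_continuous_extension[OF \<phi>(3)] by blast
  have surface: "(x, \<eta> x) \<in> S" "(x, \<eta> x) \<in> closure \<Omega>" "(x, \<eta> x) \<notin> \<Omega>" for x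
    using assms(9) in_closure_fluid_domain[of 0 x \<eta>] by (auto simp: free_surface_def fluid_domain_def \<Omega>)
  have P_surface: "gradient_closure \<Omega> \<phi> (x, \<eta> x) = P (x, \<eta> x)" for x
    by (rule gradient_closure_eq[OF P surface(2,3)])
  have kin: "P (x, \<eta> x) \<bullet> (- gradient \<eta> x, 1) = - (c' \<bullet> gradient \<eta> x)" for x
  proof -
    have "P (x, \<eta> x) \<bullet> unit_normal \<eta> x = c \<bullet> unit_normal \<eta> x"
      using assms(12) surface(1)[of x] by (force simp: P_surface)
    \<comment> \<open>The positive normalising factor of N cancels on both sides; as c has no
      vertical component, only -(c' \<bullet> \<nabla>\<eta>) remains.\<close>
    moreover have "sqrt (1 + (norm (gradient \<eta> x))\<^sup>2) > 0" by (simp add: add_pos_nonneg)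
    ultimately have "P (x, \<eta> x) \<bullet> (- gradient \<eta> x, 1) = c \<bullet> (- gradient \<eta> x, 1)"
      unfolding unit_normal_def inner_scaleR_right by simp
    then show ?thesis by (simp add: assms(5))
  qed
  have bern: "P (x, \<eta> x) \<bullet> P (x, \<eta> x) / 2 - (c', 0) \<bullet> P (x, \<eta> x) + g * \<eta> x = - \<sigma> * div_normal \<eta> (x, \<eta> x)" for x
    using assms(13) surface(1)[of x] by (force simp: P_surface assms(5) power2_norm_eq_inner)
  have decay: "\<exists>r. \<forall>x\<in>closure (fluid_domain \<eta>). r \<le> norm x \<longrightarrow> \<bar>\<phi> x\<bar> * norm x ^ (DIM(real ^ 'm) - 1) \<le> \<kappa>"
    if \<kappa>: "\<kappa> > 0" for \<kappa>
  proof -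
    have "\<forall>\<^sub>F x in at_infinity_in_closure \<Omega>. norm (\<phi> x) \<le> \<kappa> * norm (1 / norm x ^ (n - 2))"
      by (rule landau_o.smallD[OF assms(19) \<kappa>])
    then obtain r where r: "\<And>x. r \<le> norm x \<Longrightarrow> x \<in> closure \<Omega> \<Longrightarrow> \<bar>\<phi> x\<bar> \<le> \<kappa> * (1 / norm x ^ (n - 2))"
      unfolding at_infinity_in_closure_def eventually_inf_principal eventually_at_infinity by auto
    \<comment> \<open>Taking the radius at least 1 makes the norm positive, so the denominator can
      be cleared.\<close>
    have "\<bar>\<phi> x\<bar> * norm x ^ (DIM(real ^ 'm) - 1) \<le> \<kappa>" if "x \<in> closure \<Omega>" "max 1 r \<le> norm x" for x
    proof -
      have "norm x ^ (n - 2) > 0" using that by (intro zero_less_power) linarith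
      moreover have "DIM(real ^ 'm) - 1 = n - 2" using dim by simp
      ultimately show ?thesis using r[of x] that by (simp add: pos_le_divide_eq)
    qed
    then show ?thesis unfolding \<Omega> by blast
  qed
  interpret deep_water \<eta> \<phi> P H
    using C2 \<phi> assms(11) P H unfolding \<Omega> by unfold_locales auto
  obtain r where r: "\<And>x. x \<in> closure \<Omega> \<Longrightarrow> r \<le> norm x \<Longrightarrow> \<bar>\<phi> x\<bar> * norm x ^ (DIM(real ^ 'm) - 1) \<le> 1"
    using decay[of 1] unfolding \<Omega> by auto
  let ?r = "max 1 r"
  \<comment> \<open>\<phi> is bounded on the surface: over the compact ball by continuity, and
    elsewhere by the decay with \<kappa> = 1, since there the power of the norm is at least
    1.\<close>
  have "bounded ((\<lambda>x. \<phi> (x, \<eta> x)) ` cball 0 ?r)"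
    by (intro compact_imp_bounded compact_continuous_image continuous_on_subset[OF surface_values_cont(1)]) auto
  then obtain C0 where C0: "\<And>x. x \<in> cball 0 ?r \<Longrightarrow> norm (\<phi> (x, \<eta> x)) \<le> C0"
    unfolding bounded_iff by blast
  have C: "\<bar>\<phi> (x, \<eta> x)\<bar> \<le> max 1 C0" for x
  proof (cases "norm x \<le> ?r")
    case True
    then show ?thesis using C0[of x] by simp
  next
    case False
    then have *: "?r \<le> norm (x, \<eta> x)" using norm_fst_le[where x=x and y="\<eta> x"] by linarith
    then have "\<bar>\<phi> (x, \<eta> x)\<bar> * 1 \<le> \<bar>\<phi> (x, \<eta> x)\<bar> * norm (x, \<eta> x) ^ (DIM(real ^ 'm) - 1)"
      by (intro mult_left_mono one_le_power) auto
    also have "\<dots> \<le> 1" by (rule r[OF surface(2)]) (use * in simp)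
    finally show ?thesis by simp
  qed
  have "DIM(real ^ 'm) \<le> 2" using n dim by auto
  from zero_mass[OF kin bern assms(3) this C G L decay int] int show ?thesis by blast
qed

end
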